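(* For every $l \in \{1,\dots,n-1\}$ and $m \in \{l+1,\dots,n\}$, $$\mathrm{Gap}(m,l) \;\geq\; \mathrm{Gap}(m,m-1)\,\mathrm{Gap}(m-1,l).$$ In particular, for every $l \in \{1,\dots,n-1\}$, $$\mathrm{Gap}(n,l) \;\geq\; \prod_{m=l+1}^{n} \mathrm{Gap}(m,m-1).$$
   Context: Setting. Let $n\ge 2$ be an integer, $[n]=\{1,\dots,n\}$, and let $(\mathsf{X}_i,\mathcal{B}_i,\mu_i)$, $i\in[n]$, be $\sigma$-finite measure spaces in which singletons are measurable. Let $\mathbf{X}=(X_1,\dots,X_n)$ be a random element, $X_i$ taking values in $\mathsf{X}_i$, whose joint distribution $\Pi$ on $\mathsf{X}=\mathsf{X}_1\times\dots\times\mathsf{X}_n$ has density $\pi$ with respect to $\mu_1\times\dots\times\mu_n$; $\pi$ is a measurable function specified everywhere on $\mathsf{X}$. For $\Gamma\subset[n]$ write $-\Gamma=[n]\setminus\Gamma$; for nonempty $\Gamma$ let $\mathsf{X}_\Gamma=\prod_{i\in\Gamma}\mathsf{X}_i$, $\mu_\Gamma=\prod_{i\in\Gamma}\mu_i$, and let $\mathbf{X}_\Gamma$, $\mathbf{x}_\Gamma$ denote the subvectors of $\mathbf{X}$, $\mathbf{x}\in\mathsf{X}$ with indices in $\Gamma$ (in increasing order). The marginal density of $\mathbf{X}_\Gamma$ is $\pi_\Gamma(\mathbf{y})=\int_{\mathsf{X}_{-\Gamma}}\pi(\mathbf{x})\,\mu_{-\Gamma}(d\mathbf{x}_{-\Gamma})$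 with $\mathbf{x}_\Gamma=\mathbf{y}$, and $\pi_{[n]}=\pi$. For disjoint nonempty $\Lambda,\Gamma\subset[n]$ and $\mathbf{y}\in\mathsf{X}_\Lambda$ with $\pi_\Lambda(\mathbf{y})>0$, the conditional density is $\pi_{\Gamma\mid\Lambda}(\mathbf{z}\mid\mathbf{y})=\pi_{\Lambda\cup\Gamma}(\mathbf{x}_{\Lambda\cup\Gamma})/\pi_\Lambda(\mathbf{y})$ where $\mathbf{x}_\Lambda=\mathbf{y}$, $\mathbf{x}_\Gamma=\mathbf{z}$; if $\pi_\Lambda(\mathbf{y})=0$, $\pi_{\Gamma\mid\Lambda}(\cdot\mid\mathbf{y})$ is an arbitrary probability density on $\mathsf{X}_\Gamma$. If $\Lambda=\emptyset$, $\pi_{\Gamma\mid\Lambda}(\cdot\mid\mathbf{y})$ means $\pi_\Gamma(\cdot)$ (and conditions on $\mathbf{y}$, such as $\pi_\Lambda(\mathbf{y})>0$, are vacuous). Spectral gap. For a probability measure $\nu$, $L_0^2(\nu)$ is the Hilbert space of real square-integrable functions with $\int f\,d\nu=0$, with norm $\|\cdot\|_\nu$. A Markov kernel $K$ reversible with respect to $\nu$ acts on $L_0^2(\nu)$ by $Kf(x)=\int f(x')K(x,dx')$; $\|K\|_\nu=\sup_{f\in L_0^2(\nu),f\ne0}\|Kf\|_\nu/\|f\|_\nu$, and the spectral gap of $K$ is $1-\|K\|_\nu$. Gibbs samplers. For $\Lambda\subset[n]$ with $|\Lambda|\le n-1$, $\mathbf{y}\in\mathsf{X}_\Lambda$ and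 $l\in\{1,\dots,n-|\Lambda|\}$, the random-scan Gibbs sampler targeting $\pi_{-\Lambda\mid\Lambda}(\cdot\mid\mathbf{y})$ with block size $l$ is the Markov chain on $\mathsf{X}_{-\Lambda}$ that moves from $\mathbf{z}$ as follows: let $\mathbf{x}$ satisfy $\mathbf{x}_\Lambda=\mathbf{y}$, $\mathbf{x}_{-\Lambda}=\mathbf{z}$; choose $\Gamma\subset-\Lambda$ with $|\Gamma|=l$ uniformly at random; draw $\mathbf{w}\in\mathsf{X}_\Gamma$ from $\pi_{\Gamma\mid-\Gamma}(\cdot\mid\mathbf{x}_{-\Gamma})$; let $\mathbf{x}'_\Gamma=\mathbf{w}$, $\mathbf{x}'_{-\Gamma}=\mathbf{x}_{-\Gamma}$; the new state is $\mathbf{x}'_{-\Lambda}$. When $\pi_\Lambda(\mathbf{y})>0$ this chain is reversible with respect to $\pi_{-\Lambda\mid\Lambda}(\cdot\mid\mathbf{y})$; let $\mathrm{gap}(\Lambda,\mathbf{y},l)$ be its spectral gap. For $l\in\{1,\dots,n\}$ and $m\in\{l,\dots,n\}$, $$\mathrm{Gap}(m,l)=\min_{\Lambda\subset[n],\,|\Lambda|=n-m}\ \inf_{\mathbf{y}\in\mathsf{X}_\Lambda,\ \pi_\Lambda(\mathbf{y})>0}\mathrm{gap}(\Lambda,\mathbf{y},l).$$ In particular $\mathrm{Gap}(n,l)$ is the spectral gap of the Gibbs sampler targeting $\pi$ with block size $l$. *)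

theory Defs
  imports "HOL-Probability.Probability"
begin


definition prob_density :: "'b measure \<Rightarrow> ('b \<Rightarrow> real) \<Rightarrow> bool" where
  "prob_density N f \<longleftrightarrow>
     f \<in> borel_measurable N \<and> (\<forall>x\<in>space N. 0 \<le> f x) \<and> (\<integral>\<^sup>+x. ennreal (f x) \<partial>N) = 1"

text \<open>
  Elements of \<open>L20 \<nu>\<close> are representatives, so ``\<open>f \<noteq> 0\<close>'' in the space of
  equivalence classes is expressed below as \<open>l2_norm \<nu> f \<noteq> 0\<close>.
\<close>

definition L20 :: "'b measure \<Rightarrow> ('b \<Rightarrow> real) set" where
  "L20 \<nu> = {f \<in> borel_measurable \<nu>. integrable \<nu> (\<lambda>x. (f x)\<^sup>2) \<and> (\<integral>x. f x \<partial>\<nu>) = 0}"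

text \<open>
  The nonnegative integral is invariant under changes of the integrand on a null set even when the
  integrand is not measurable. Hence the norm of \<open>K f\<close> is unaffected by the values of the kernel
  on a \<open>\<nu>\<close>-null set, where the conditional densities below may be chosen arbitrarily.
\<close>

definition l2_norm :: "'b measure \<Rightarrow> ('b \<Rightarrow> real) \<Rightarrow> real" where
  "l2_norm \<nu> f = sqrt (enn2real (\<integral>\<^sup>+x. ennreal ((f x)\<^sup>2) \<partial>\<nu>))"

definition kernel_op :: "('b \<Rightarrow> 'b measure) \<Rightarrow> ('b \<Rightarrow> real) \<Rightarrow> 'b \<Rightarrow> real" where
  "kernel_op K f x = (\<integral>x'. f x' \<partial>K x)"

text \<open>
  All quotients are nonnegative, so inserting \<open>0\<close> only fixes the supremum to be \<open>0\<close> when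
  \<open>L20 \<nu>\<close> has no nonzero element. For a kernel reversible with respect to \<open>\<nu>\<close> the quotients
  are bounded by \<open>1\<close>.
\<close>

definition kernel_norm :: "'b measure \<Rightarrow> ('b \<Rightarrow> 'b measure) \<Rightarrow> real" where
  "kernel_norm \<nu> K =
     Sup (insert 0 {l2_norm \<nu> (kernel_op K f) / l2_norm \<nu> f | f. f \<in> L20 \<nu> \<and> l2_norm \<nu> f \<noteq> 0})"

definition spectral_gap :: "'b measure \<Rightarrow> ('b \<Rightarrow> 'b measure) \<Rightarrow> real" where
  "spectral_gap \<nu> K = 1 - kernel_norm \<nu> K"



text \<open>
  The space with index set \<open>\<Gamma> \<subseteq> {1..n}\<close> is \<open>Pi\<^sub>M \<Gamma> M\<close>; its points are functions that
  are \<open>undefined\<close> outside \<open>\<Gamma>\<close>, so \<open>restrict x \<Gamma>\<close> is the subvector of \<open>x\<close> with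
  indices in \<open>\<Gamma>\<close>. The spaces \<open>space (M i)\<close> are arbitrary subsets of the common type \<open>'a\<close>.
  The parameter \<open>alt\<close> supplies the arbitrary conditional densities: \<open>alt \<Gamma> \<Lambda> y\<close> is
  used as density on \<open>Pi\<^sub>M \<Gamma> M\<close> when the marginal density of \<open>\<Lambda>\<close> vanishes at \<open>y\<close>.
\<close>

context
  fixes n :: nat
    and M :: "nat \<Rightarrow> 'a measure"
    and \<pi> :: "(nat \<Rightarrow> 'a) \<Rightarrow> real"
    and alt :: "nat set \<Rightarrow> nat set \<Rightarrow> (nat \<Rightarrow> 'a) \<Rightarrow> (nat \<Rightarrow> 'a) \<Rightarrow> real"
begin

text \<open>
  The marginal density is real-valued. If the integral diverges, which happens only on a null set
  of \<open>y\<close>, its value is \<open>0\<close> by the convention of the Bochner integral, and \<open>y\<close> is treated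
  like the other points at which the conditional density is arbitrary.
\<close>

definition marginal :: "nat set \<Rightarrow> (nat \<Rightarrow> 'a) \<Rightarrow> real" where
  "marginal \<Gamma> y = (\<integral>w. \<pi> (merge \<Gamma> ({1..n} - \<Gamma>) (y, w)) \<partial>Pi\<^sub>M ({1..n} - \<Gamma>) M)"

lemma marginal_full:
  assumes "x \<in> space (Pi\<^sub>M {1..n} M)"
  shows "marginal {1..n} x = \<pi> x"
proof -
  have "merge {1..n} {} (x, w) = x" for w
    using assms by (auto simp: merge_def space_PiM PiE_def extensional_def fun_eq_iff)
  then show ?thesis
    by (simp add: marginal_def lebesgue_integral_count_space_finite PiM_empty)
qed

text \<open>\<open>cond_density \<Gamma> \<Lambda> y z\<close> is the density of the coordinates in \<open>\<Gamma>\<close> at \<open>z\<close>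
  given that those in \<open>\<Lambda>\<close> equal \<open>y\<close>.\<close>

definition cond_density :: "nat set \<Rightarrow> nat set \<Rightarrow> (nat \<Rightarrow> 'a) \<Rightarrow> (nat \<Rightarrow> 'a) \<Rightarrow> real" where
  "cond_density \<Gamma> \<Lambda> y z =
     (if \<Lambda> = {} then marginal \<Gamma> z
      else if 0 < marginal \<Lambda> y then marginal (\<Lambda> \<union> \<Gamma>) (merge \<Lambda> \<Gamma> (y, z)) / marginal \<Lambda> y
      else alt \<Gamma> \<Lambda> y z)"

definition gibbs_target :: "nat set \<Rightarrow> (nat \<Rightarrow> 'a) \<Rightarrow> (nat \<Rightarrow> 'a) measure" where
  "gibbs_target \<Lambda> y =
     density (Pi\<^sub>M ({1..n} - \<Lambda>) M) (\<lambda>z. ennreal (cond_density ({1..n} - \<Lambda>) \<Lambda> y z))"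

text \<open>Law of the coordinates outside \<open>\<Lambda>\<close> after the block \<open>\<Gamma>\<close> of \<open>x\<close> has been
  redrawn.\<close>

definition block_update :: "nat set \<Rightarrow> nat set \<Rightarrow> (nat \<Rightarrow> 'a) \<Rightarrow> (nat \<Rightarrow> 'a) measure" where
  "block_update \<Lambda> \<Gamma> x =
     distr
       (density (Pi\<^sub>M \<Gamma> M)
          (\<lambda>w. ennreal (cond_density \<Gamma> ({1..n} - \<Gamma>) (restrict x ({1..n} - \<Gamma>)) w)))
       (Pi\<^sub>M ({1..n} - \<Lambda>) M)
       (\<lambda>w. restrict (merge \<Gamma> ({1..n} - \<Gamma>) (w, x)) ({1..n} - \<Lambda>))"

definition gibbs_kernel ::
    "nat set \<Rightarrow> (nat \<Rightarrow> 'a) \<Rightarrow> nat \<Rightarrow> (nat \<Rightarrow> 'a) \<Rightarrow> (nat \<Rightarrow> 'a) measure" where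
  "gibbs_kernel \<Lambda> y l z =
     uniform_count_measure {\<Gamma>. \<Gamma> \<subseteq> {1..n} - \<Lambda> \<and> card \<Gamma> = l} \<bind>
       (\<lambda>\<Gamma>. block_update \<Lambda> \<Gamma> (merge \<Lambda> ({1..n} - \<Lambda>) (y, z)))"

definition gibbs_gap :: "nat set \<Rightarrow> (nat \<Rightarrow> 'a) \<Rightarrow> nat \<Rightarrow> real" where
  "gibbs_gap \<Lambda> y l = spectral_gap (gibbs_target \<Lambda> y) (gibbs_kernel \<Lambda> y l)"

definition Gap :: "nat \<Rightarrow> nat \<Rightarrow> real" where
  "Gap m l =
     Min ((\<lambda>\<Lambda>. INF y \<in> {y \<in> space (Pi\<^sub>M \<Lambda> M). \<Lambda> = {} \<or> 0 < marginal \<Lambda> y}. gibbs_gap \<Lambda> y l) `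
       {\<Lambda>. \<Lambda> \<subseteq> {1..n} \<and> card \<Lambda> = n - m})"

end

end

theory Submission
  imports Defs
begin

text \<open>
  Redrawing one block of coordinates from its conditional law given the others is a conditional
  expectation, so it acts as an orthogonal projection \<open>P\<^sub>\<Gamma>\<close> on the square-integrable functions
  of the target \<open>\<nu>\<close>, and the kernel \<open>K\<close> of a random-scan Gibbs sampler is the average of
  these projections. Being self-adjoint and positive, \<open>K\<close> has norm at most \<open>1 - g\<close> on the
  functions of mean zero (\<open>0 \<le> g \<le> 1\<close>) iff the Poincare inequality
  \<open>g Var(f) \<le> avg\<^sub>\<Gamma> (\<parallel>f\<parallel>\<^sup>2 - \<parallel>P\<^sub>\<Gamma> f\<parallel>\<^sup>2)\<close> holds for every square-integrable \<open>f\<close>. These are the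
  lemmas \<open>poincare_spectral_gap\<close> and \<open>spectral_gap_greatest\<close>.

  Now let the target live on the coordinates in \<open>J\<close> with \<open>card J = m\<close>. A uniform block of
  size \<open>l < m\<close> can be chosen by first choosing \<open>i \<in> J\<close> uniformly and then a uniform block of size
  \<open>l\<close> inside \<open>J - {i}\<close>. For fixed \<open>i\<close>, conditionally on the coordinate \<open>i\<close>, redrawing the
  blocks inside \<open>J - {i}\<close> is a Gibbs sampler on \<open>m - 1\<close> coordinates, whose Poincare constant
  is at least \<open>Gap(m - 1, l)\<close>. Integrating its Poincare inequality over the coordinate \<open>i\<close>
  (\<open>dirichlet_form_conditional\<close>) gives
  \<open>Gap(m - 1, l) (\<parallel>f\<parallel>\<^sup>2 - \<parallel>P\<^bsub>J - {i}\<^esub> f\<parallel>\<^sup>2) \<le> avg\<^bsub>\<Gamma> \<subseteq> J - {i}\<^esub> (\<parallel>f\<parallel>\<^sup>2 - \<parallel>P\<^sub>\<Gamma> f\<parallel>\<^sup>2)\<close>.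
  The average over \<open>i\<close> of the bracket on the left is the Dirichlet form of the sampler with block
  size \<open>m - 1\<close>, hence at least \<open>Gap(m, m - 1) Var(f)\<close>; this is \<open>poincare_compose\<close>.

  The remaining work is measure-theoretic: block redraws of a density on a finite product leave
  the law of that density invariant (\<open>projection_kernel_resample\<close>), redraws inside a sub-block
  commute with conditioning (\<open>resample_nested\<close>), and the exceptional points at which a marginal
  density vanishes or diverges form a null set (\<open>AE_block_mass_pos\<close>).
\<close>

section \<open>Square-integrable functions\<close>

text \<open>The square-integrable functions, as representatives; \<open>L20\<close> consists of those with mean zero.\<close>

definition L2 :: "'b measure \<Rightarrow> ('b \<Rightarrow> real) set" where
  "L2 \<nu> = {f \<in> borel_measurable \<nu>. integrable \<nu> (\<lambda>x. (f x)\<^sup>2)}"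

lemma L2_measurable: "f \<in> L2 \<nu> \<Longrightarrow> f \<in> borel_measurable \<nu>"
  by (simp add: L2_def)

lemma L2_square: "f \<in> L2 \<nu> \<Longrightarrow> integrable \<nu> (\<lambda>x. (f x)\<^sup>2)"
  by (simp add: L2_def)

lemma L2_mult:
  assumes "f \<in> L2 \<nu>" "g \<in> L2 \<nu>"
  shows "integrable \<nu> (\<lambda>x. f x * g x)"
proof (rule Bochner_Integration.integrable_bound)
  show "integrable \<nu> (\<lambda>x. (f x)\<^sup>2 + (g x)\<^sup>2)"
    using assms by (auto simp: L2_def)
  show "(\<lambda>x. f x * g x) \<in> borel_measurable \<nu>"
    using assms by (auto simp: L2_def)
  have "\<bar>a * b\<bar> \<le> a\<^sup>2 + b\<^sup>2" for a b :: real
  proof -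
    have "2 * (\<bar>a\<bar> * \<bar>b\<bar>) \<le> a\<^sup>2 + b\<^sup>2"
      using sum_squares_bound[of "\<bar>a\<bar>" "\<bar>b\<bar>"] by (simp add: mult.assoc)
    moreover have "0 \<le> \<bar>a\<bar> * \<bar>b\<bar>" by simp
    ultimately show ?thesis unfolding abs_mult by linarith
  qed
  then show "AE x in \<nu>. norm (f x * g x) \<le> norm ((f x)\<^sup>2 + (g x)\<^sup>2)"
    by (simp add: real_norm_def)
qed

lemma L2_add:
  assumes "f \<in> L2 \<nu>" "g \<in> L2 \<nu>"
  shows "(\<lambda>x. f x + g x) \<in> L2 \<nu>"
  using assms L2_mult[OF assms]
  by (auto simp: L2_def power2_sum mult.assoc)

lemma L2_cmult:
  assumes "f \<in> L2 \<nu>"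
  shows "(\<lambda>x. c * f x) \<in> L2 \<nu>"
  using assms by (auto simp: L2_def power_mult_distrib)

lemma L2_sum:
  assumes "finite A" "\<And>a. a \<in> A \<Longrightarrow> f a \<in> L2 \<nu>"
  shows "(\<lambda>x. \<Sum>a\<in>A. f a x) \<in> L2 \<nu>"
  using assms
proof (induction A rule: finite_induct)
  case empty
  then show ?case by (simp add: L2_def)
next
  case (insert a A)
  then show ?case using L2_add[of "f a" \<nu> "\<lambda>x. \<Sum>a\<in>A. f a x"] by simp
qed

lemma (in prob_space) L2_const: "(\<lambda>_. c) \<in> L2 M"
  by (simp add: L2_def)

lemma (in prob_space) L2_integrable:
  assumes "f \<in> L2 M"
  shows "integrable M f"
  using L2_mult[OF assms L2_const[of 1]] by simp

lemma (in prob_space) L2_square_expectation_le: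
  assumes "f \<in> L2 M"
  shows "(expectation f)\<^sup>2 \<le> expectation (\<lambda>x. (f x)\<^sup>2)"
proof -
  have "variance f = expectation (\<lambda>x. (f x)\<^sup>2) - (expectation f)\<^sup>2"
    using assms L2_integrable[OF assms] by (intro variance_eq) (auto simp: L2_def)
  then show ?thesis using variance_positive[of f] by simp
qed

lemma l2_norm_L2:
  assumes "f \<in> L2 \<nu>"
  shows "(l2_norm \<nu> f)\<^sup>2 = (\<integral>x. (f x)\<^sup>2 \<partial>\<nu>)"
proof -
  have "(\<integral>\<^sup>+x. ennreal ((f x)\<^sup>2) \<partial>\<nu>) = ennreal (\<integral>x. (f x)\<^sup>2 \<partial>\<nu>)"
    using assms by (intro nn_integral_eq_integral) (auto simp: L2_def)
  then show ?thesis by (simp add: l2_norm_def)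
qed

lemma l2_norm_cong_AE:
  assumes "AE x in \<nu>. f x = g x"
  shows "l2_norm \<nu> f = l2_norm \<nu> g"
proof -
  have "(\<integral>\<^sup>+x. ennreal ((f x)\<^sup>2) \<partial>\<nu>) = (\<integral>\<^sup>+x. ennreal ((g x)\<^sup>2) \<partial>\<nu>)"
    using assms by (intro nn_integral_cong_AE) auto
  then show ?thesis by (simp add: l2_norm_def)
qed

lemma l2_norm_nonneg: "0 \<le> l2_norm \<nu> f"
  by (simp add: l2_norm_def)

lemma L20_L2: "f \<in> L20 \<nu> \<longleftrightarrow> f \<in> L2 \<nu> \<and> (\<integral>x. f x \<partial>\<nu>) = 0"
  by (auto simp: L20_def L2_def)

lemma L2_cross_le:
  assumes f: "f \<in> L2 \<nu>" and g: "g \<in> L2 \<nu>" and t: "0 < t"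
  shows "2 * (\<integral>x. f x * g x \<partial>\<nu>) \<le> t * (\<integral>x. (f x)\<^sup>2 \<partial>\<nu>) + (\<integral>x. (g x)\<^sup>2 \<partial>\<nu>) / t"
proof -
  have pt: "2 * (a * b) \<le> t * a\<^sup>2 + b\<^sup>2 / t" for a b :: real
  proof -
    have "0 \<le> (t * a - b)\<^sup>2 / t" using t by simp
    also have "\<dots> = t * a\<^sup>2 + b\<^sup>2 / t - 2 * (a * b)"
      using t by (simp add: power2_eq_square field_simps)
    finally show ?thesis by simp
  qed
  have "(\<integral>x. 2 * (f x * g x) \<partial>\<nu>) \<le> (\<integral>x. t * (f x)\<^sup>2 + (g x)\<^sup>2 / t \<partial>\<nu>)"
    using L2_mult[OF f g] L2_square[OF f] L2_square[OF g] pt by (intro integral_mono) auto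
  then show ?thesis
    using L2_square[OF f] L2_square[OF g] by simp
qed

lemma L2_Cauchy_Schwarz:
  assumes f: "f \<in> L2 \<nu>" and g: "g \<in> L2 \<nu>"
  shows "(\<integral>x. f x * g x \<partial>\<nu>) \<le> l2_norm \<nu> f * l2_norm \<nu> g"
proof -
  let ?x = "l2_norm \<nu> f" and ?y = "l2_norm \<nu> g" and ?I = "\<integral>x. f x * g x \<partial>\<nu>"
  \<comment> \<open>Adding \<open>e\<close> keeps both factors positive, so that the optimal weight \<open>t = Y / X\<close> in
    \<open>L2_cross_le\<close> exists; then let \<open>e\<close> tend to \<open>0\<close>.\<close>
  have "?I \<le> (?x + e) * (?y + e)" if e: "0 < e" for e
  proof -
    define X Y where "X = ?x + e" and "Y = ?y + e"
    have X: "0 < X" "?x\<^sup>2 \<le> X\<^sup>2" and Y: "0 < Y" "?y\<^sup>2 \<le> Y\<^sup>2"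
      using e l2_norm_nonneg[of \<nu> f] l2_norm_nonneg[of \<nu> g]
      by (auto simp: X_def Y_def intro!: power_mono)
    have "2 * ?I \<le> Y / X * ?x\<^sup>2 + ?y\<^sup>2 / (Y / X)"
      using L2_cross_le[OF f g, of "Y / X"] X Y f g by (simp add: l2_norm_L2)
    also have "\<dots> \<le> Y / X * X\<^sup>2 + Y\<^sup>2 / (Y / X)"
      using X Y by (intro add_mono mult_left_mono divide_right_mono) auto
    also have "\<dots> = 2 * (X * Y)" using X Y by (simp add: power2_eq_square)
    finally show ?thesis by (simp add: X_def Y_def)
  qed
  then have "\<forall>\<^sub>F e in at_right 0. ?I \<le> (?x + e) * (?y + e)"
    by (auto simp: eventually_at_filter)
  moreover have "((\<lambda>e. (?x + e) * (?y + e)) \<longlongrightarrow> (?x + 0) * (?y + 0)) (at_right 0)"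
    by (intro tendsto_intros)
  ultimately show ?thesis
    by (intro tendsto_lowerbound[where F="at_right (0::real)" and f="\<lambda>e. (?x + e) * (?y + e)"]) auto
qed

section \<open>Kernels acting as orthogonal projections\<close>

text \<open>
  A kernel that leaves \<open>\<nu>\<close> invariant and whose action \<open>kernel_op Q f\<close> is almost surely
  constant under \<open>Q x\<close>. This is the pattern of a regular conditional distribution of \<open>\<nu>\<close>
  given the coordinates that \<open>Q\<close> does not move. The assumption \<open>proper\<close> is stated for the
  functions \<open>kernel_op Q f\<close>, not as \<open>Q x' = Q x\<close>, because the exceptional sets of the former
  are measurable.
\<close>

locale projection_kernel = prob_space \<nu> for \<nu> :: "'b measure" +
  fixes Q :: "'b \<Rightarrow> 'b measure"
  assumes kernel[measurable]: "Q \<in> \<nu> \<rightarrow>\<^sub>M prob_algebra \<nu>"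
    and stationary: "\<nu> \<bind> Q = \<nu>"
    and proper: "f \<in> borel_measurable \<nu> \<Longrightarrow>
      AE x in \<nu>. AE x' in Q x. kernel_op Q f x' = kernel_op Q f x"
begin

lemma kernel_subprob[measurable]: "Q \<in> \<nu> \<rightarrow>\<^sub>M subprob_algebra \<nu>"
  by (rule measurable_prob_algebraD) (rule kernel)

lemma kernel_prob: "x \<in> space \<nu> \<Longrightarrow> prob_space (Q x)"
  and sets_kernel_at: "x \<in> space \<nu> \<Longrightarrow> sets (Q x) = sets \<nu>"
  using measurable_space[OF kernel] by (auto simp: space_prob_algebra)

lemma measurable_kernel_eq: "x \<in> space \<nu> \<Longrightarrow> borel_measurable (Q x) = borel_measurable \<nu>"
  by (rule measurable_cong_sets) (auto simp: sets_kernel_at)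

lemma nn_integral_tower:
  assumes "f \<in> borel_measurable \<nu>"
  shows "(\<integral>\<^sup>+x. \<integral>\<^sup>+x'. f x' \<partial>Q x \<partial>\<nu>) = (\<integral>\<^sup>+x. f x \<partial>\<nu>)"
  using nn_integral_bind[OF assms kernel_subprob] stationary by simp

lemma measurable_kernel_op[measurable]:
  fixes f :: "'b \<Rightarrow> real"
  assumes f: "f \<in> borel_measurable \<nu>"
  shows "kernel_op Q f \<in> borel_measurable \<nu>"
  unfolding kernel_op_def
  by (rule measurable_compose[OF kernel_subprob integral_measurable_subprob_algebra[OF f]])

text \<open>The law of total expectation for integrable functions.\<close>

lemma tower:
  fixes f :: "'b \<Rightarrow> real"
  assumes f: "integrable \<nu> f"
  shows AE_integrable_kernel: "AE x in \<nu>. integrable (Q x) f"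
    and integrable_kernel_op: "integrable \<nu> (kernel_op Q f)"
    and integral_kernel_op: "(\<integral>x. kernel_op Q f x \<partial>\<nu>) = (\<integral>x. f x \<partial>\<nu>)"
proof -
  have fm[measurable]: "f \<in> borel_measurable \<nu>" using f by auto
  have fin: "(\<integral>\<^sup>+x. ennreal \<bar>f x\<bar> \<partial>\<nu>) < \<infinity>" using f by (auto simp: integrable_iff_bounded)
  have m: "(\<lambda>x. \<integral>\<^sup>+x'. g x' \<partial>Q x) \<in> borel_measurable \<nu>"
    if "g \<in> borel_measurable \<nu>" for g :: "'b \<Rightarrow> ennreal"
    using that by (rule measurable_compose[OF kernel_subprob nn_integral_measurable_subprob_algebra])
  have "AE x in \<nu>. (\<integral>\<^sup>+x'. ennreal \<bar>f x'\<bar> \<partial>Q x) \<noteq> \<infinity>"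
    using fin by (intro nn_integral_PInf_AE m) (auto simp: nn_integral_tower)
  then show AEi: "AE x in \<nu>. integrable (Q x) f"
    using AE_space
    by eventually_elim (auto simp: integrable_iff_bounded measurable_kernel_eq less_top)
  have pos: "integrable \<nu> (kernel_op Q g) \<and> (\<integral>x. kernel_op Q g x \<partial>\<nu>) = (\<integral>x. g x \<partial>\<nu>)"
    if g: "integrable \<nu> g" "\<And>x. 0 \<le> g x" and gi: "AE x in \<nu>. integrable (Q x) g" for g
  proof -
    have [measurable]: "g \<in> borel_measurable \<nu>" using g by auto
    have "(\<integral>\<^sup>+x. ennreal (kernel_op Q g x) \<partial>\<nu>) = (\<integral>\<^sup>+x. \<integral>\<^sup>+x'. ennreal (g x') \<partial>Q x \<partial>\<nu>)"
    proof (rule nn_integral_cong_AE)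
      show "AE x in \<nu>. ennreal (kernel_op Q g x) = (\<integral>\<^sup>+x'. ennreal (g x') \<partial>Q x)"
        using gi by eventually_elim (simp add: kernel_op_def nn_integral_eq_integral g)
    qed
    also have "\<dots> = (\<integral>\<^sup>+x. ennreal (g x) \<partial>\<nu>)" by (rule nn_integral_tower) simp
    also have "\<dots> = ennreal (\<integral>x. g x \<partial>\<nu>)" using g by (simp add: nn_integral_eq_integral)
    finally have "has_bochner_integral \<nu> (kernel_op Q g) (\<integral>x. g x \<partial>\<nu>)"
      using g by (intro has_bochner_integral_nn_integral) (auto simp: kernel_op_def[abs_def])
    then show ?thesis by (auto simp: has_bochner_integral_iff)
  qed
  have pi: "AE x in \<nu>. integrable (Q x) (\<lambda>x. max 0 (f x))"
    and qi: "AE x in \<nu>. integrable (Q x) (\<lambda>x. max 0 (- f x))"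
    using AEi by (eventually_elim, simp)+
  have P: "integrable \<nu> (kernel_op Q (\<lambda>x. max 0 (f x)))"
      "(\<integral>x. kernel_op Q (\<lambda>x. max 0 (f x)) x \<partial>\<nu>) = (\<integral>x. max 0 (f x) \<partial>\<nu>)"
    and N: "integrable \<nu> (kernel_op Q (\<lambda>x. max 0 (- f x)))"
      "(\<integral>x. kernel_op Q (\<lambda>x. max 0 (- f x)) x \<partial>\<nu>) = (\<integral>x. max 0 (- f x) \<partial>\<nu>)"
    using pos[OF _ _ pi] pos[OF _ _ qi] f by auto
  have "AE x in \<nu>. kernel_op Q f x
      = kernel_op Q (\<lambda>x. max 0 (f x)) x - kernel_op Q (\<lambda>x. max 0 (- f x)) x"
    using pi qi
  proof eventually_elim
    case (elim x)
    have "kernel_op Q f x = (\<integral>x'. max 0 (f x') - max 0 (- f x') \<partial>Q x)"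
      unfolding kernel_op_def by (rule Bochner_Integration.integral_cong) auto
    then show ?case
      using elim by (simp add: kernel_op_def)
  qed
  then have eq: "AE x in \<nu>. kernel_op Q (\<lambda>x. max 0 (f x)) x - kernel_op Q (\<lambda>x. max 0 (- f x)) x
      = kernel_op Q f x"
    by eventually_elim simp
  show "integrable \<nu> (kernel_op Q f)"
    by (rule integrable_cong_AE_imp[OF Bochner_Integration.integrable_diff[OF P(1) N(1)] _ eq])
       measurable
  have "(\<integral>x. kernel_op Q f x \<partial>\<nu>)
      = (\<integral>x. kernel_op Q (\<lambda>x. max 0 (f x)) x - kernel_op Q (\<lambda>x. max 0 (- f x)) x \<partial>\<nu>)"
    using eq by (intro integral_cong_AE) auto
  also have "\<dots> = (\<integral>x. max 0 (f x) \<partial>\<nu>) - (\<integral>x. max 0 (- f x) \<partial>\<nu>)"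
    using P N by simp
  also have "\<dots> = (\<integral>x. max 0 (f x) - max 0 (- f x) \<partial>\<nu>)"
    using f by simp
  also have "\<dots> = (\<integral>x. f x \<partial>\<nu>)"
    by (rule Bochner_Integration.integral_cong) auto
  finally show "(\<integral>x. kernel_op Q f x \<partial>\<nu>) = (\<integral>x. f x \<partial>\<nu>)" .
qed

lemma AE_L2_kernel:
  assumes "f \<in> L2 \<nu>"
  shows "AE x in \<nu>. f \<in> L2 (Q x)"
  using AE_integrable_kernel[OF L2_square[OF assms]] AE_space
  by eventually_elim (use L2_measurable[OF assms] in \<open>auto simp: L2_def measurable_kernel_eq\<close>)

lemma square_kernel_op_le:
  assumes "f \<in> L2 \<nu>"
  shows "AE x in \<nu>. (kernel_op Q f x)\<^sup>2 \<le> kernel_op Q (\<lambda>x. (f x)\<^sup>2) x"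
  using AE_L2_kernel[OF assms] AE_space
  by eventually_elim (auto simp: kernel_op_def intro!: prob_space.L2_square_expectation_le kernel_prob)

lemma kernel_op_L2:
  assumes "f \<in> L2 \<nu>"
  shows "kernel_op Q f \<in> L2 \<nu>"
proof -
  have [measurable]: "f \<in> borel_measurable \<nu>" using assms by (rule L2_measurable)
  have "AE x in \<nu>. norm ((kernel_op Q f x)\<^sup>2) \<le> norm (kernel_op Q (\<lambda>x. (f x)\<^sup>2) x)"
    using square_kernel_op_le[OF assms] by eventually_elim simp
  then have "integrable \<nu> (\<lambda>x. (kernel_op Q f x)\<^sup>2)"
    by (intro Bochner_Integration.integrable_bound[OF integrable_kernel_op[OF L2_square[OF assms]]])
       measurable
  then show ?thesis by (auto simp: L2_def)
qed

lemma kernel_op_contraction: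
  assumes "f \<in> L2 \<nu>"
  shows "(\<integral>x. (kernel_op Q f x)\<^sup>2 \<partial>\<nu>) \<le> (\<integral>x. (f x)\<^sup>2 \<partial>\<nu>)"
proof -
  have "(\<integral>x. (kernel_op Q f x)\<^sup>2 \<partial>\<nu>) \<le> (\<integral>x. kernel_op Q (\<lambda>x. (f x)\<^sup>2) x \<partial>\<nu>)"
    using square_kernel_op_le[OF assms]
    by (intro integral_mono_AE L2_square kernel_op_L2 integrable_kernel_op assms) auto
  then show ?thesis using integral_kernel_op[OF L2_square[OF assms]] by simp
qed

text \<open>The kernel acts as an orthogonal projection: \<open>\<langle>f, P g\<rangle> = \<langle>P f, P g\<rangle>\<close>.\<close>

lemma kernel_op_projection:
  assumes f: "f \<in> L2 \<nu>" and g: "g \<in> L2 \<nu>"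
  shows "(\<integral>x. f x * kernel_op Q g x \<partial>\<nu>) = (\<integral>x. kernel_op Q f x * kernel_op Q g x \<partial>\<nu>)"
proof -
  note i = L2_mult[OF f kernel_op_L2[OF g]]
  have [measurable]: "f \<in> borel_measurable \<nu>" "g \<in> borel_measurable \<nu>"
    using f g by (auto simp: L2_measurable)
  have "(\<integral>x. f x * kernel_op Q g x \<partial>\<nu>) = (\<integral>x. kernel_op Q (\<lambda>x. f x * kernel_op Q g x) x \<partial>\<nu>)"
    using integral_kernel_op[OF i] by simp
  also have "\<dots> = (\<integral>x. kernel_op Q f x * kernel_op Q g x \<partial>\<nu>)"
  proof (rule integral_cong_AE)
    show "AE x in \<nu>. kernel_op Q (\<lambda>x. f x * kernel_op Q g x) x = kernel_op Q f x * kernel_op Q g x"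
      using proper[OF L2_measurable[OF g]] AE_integrable_kernel[OF L2_integrable[OF f]] AE_space
    proof eventually_elim
      case (elim x)
      have "kernel_op Q (\<lambda>x. f x * kernel_op Q g x) x = (\<integral>x'. f x' * kernel_op Q g x \<partial>Q x)"
        unfolding kernel_op_def[of Q "\<lambda>x. f x * kernel_op Q g x"]
      proof (rule integral_cong_AE)
        show "AE x' in Q x. f x' * kernel_op Q g x' = f x' * kernel_op Q g x"
          using elim(1) by eventually_elim simp
      qed (use elim in \<open>auto simp: measurable_kernel_eq\<close>)
      also have "\<dots> = kernel_op Q f x * kernel_op Q g x"
        using elim by (simp add: kernel_op_def)
      finally show ?case .
    qed
  qed measurable
  finally show ?thesis .
qed

end

section \<open>Spectral gaps of mixtures of projections\<close>

text \<open>
  The average over \<open>a \<in> A\<close> of \<open>\<parallel>f\<parallel>\<^sup>2 - \<parallel>Q\<^sub>a f\<parallel>\<^sup>2\<close>. When every \<open>Q a\<close> acts as an orthogonal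
  projection, this is the Dirichlet form \<open>\<langle>f, (I - K) f\<rangle>\<close> of the uniform mixture \<open>K\<close>.
\<close>

definition dirichlet_form :: "'b measure \<Rightarrow> 'i set \<Rightarrow> ('i \<Rightarrow> 'b \<Rightarrow> 'b measure) \<Rightarrow> ('b \<Rightarrow> real) \<Rightarrow> real" where
  "dirichlet_form \<nu> A Q f =
     (\<Sum>a\<in>A. (\<integral>x. (f x)\<^sup>2 \<partial>\<nu>) - (\<integral>x. (kernel_op (Q a) f x)\<^sup>2 \<partial>\<nu>)) / real (card A)"

text \<open>The Poincare inequality with constant \<open>g\<close> for the uniform mixture of the \<open>Q a\<close>, over
  all square-integrable functions, with the variance on the smaller side.\<close>

definition poincare :: "'b measure \<Rightarrow> 'i set \<Rightarrow> ('i \<Rightarrow> 'b \<Rightarrow> 'b measure) \<Rightarrow> real \<Rightarrow> bool" where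
  "poincare \<nu> A Q g \<longleftrightarrow>
     (\<forall>f\<in>L2 \<nu>. g * ((\<integral>x. (f x)\<^sup>2 \<partial>\<nu>) - (\<integral>x. f x \<partial>\<nu>)\<^sup>2) \<le> dirichlet_form \<nu> A Q f)"

text \<open>
  A kernel \<open>K\<close> that acts, at almost every point, as the uniform mixture of finitely many
  projection kernels. At the exceptional points \<open>K\<close> is unconstrained and need not be measurable.
\<close>

locale projection_mixture = prob_space \<nu> for \<nu> :: "'b measure" +
  fixes A :: "'i set" and Q :: "'i \<Rightarrow> 'b \<Rightarrow> 'b measure" and K :: "'b \<Rightarrow> 'b measure"
  assumes fin: "finite A" and ne: "A \<noteq> {}"
    and proj: "a \<in> A \<Longrightarrow> projection_kernel \<nu> (Q a)"
    and mixture: "AE x in \<nu>. \<forall>f. (\<forall>a\<in>A. integrable (Q a x) f) \<longrightarrow>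
       kernel_op K f x = (\<Sum>a\<in>A. kernel_op (Q a) f x) / real (card A)"
begin

text \<open>The average of the projections, a measurable version of \<open>kernel_op K f\<close> for
  square-integrable \<open>f\<close>.\<close>

definition avg :: "('b \<Rightarrow> real) \<Rightarrow> 'b \<Rightarrow> real" where
  "avg f x = (\<Sum>a\<in>A. kernel_op (Q a) f x) / real (card A)"

lemma card_pos: "0 < real (card A)"
  using fin ne by (simp add: card_gt_0_iff)

lemma avg_L2:
  assumes "f \<in> L2 \<nu>"
  shows "avg f \<in> L2 \<nu>"
proof -
  have "(\<lambda>x. \<Sum>a\<in>A. kernel_op (Q a) f x) \<in> L2 \<nu>"
    using proj assms by (intro L2_sum fin projection_kernel.kernel_op_L2) auto
  from L2_cmult[OF this, of "1 / real (card A)"] show ?thesis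
    by (simp add: avg_def[abs_def])
qed

lemma kernel_op_L2: "f \<in> L2 \<nu> \<Longrightarrow> a \<in> A \<Longrightarrow> kernel_op (Q a) f \<in> L2 \<nu>"
  using proj by (rule projection_kernel.kernel_op_L2)

lemma l2_norm_mixture:
  assumes f: "f \<in> L2 \<nu>"
  shows "l2_norm \<nu> (kernel_op K f) = l2_norm \<nu> (avg f)"
proof (rule l2_norm_cong_AE)
  have "AE x in \<nu>. \<forall>a\<in>A. integrable (Q a x) f"
    using fin projection_kernel.AE_integrable_kernel[OF proj L2_integrable[OF f]]
    by (intro AE_finite_allI) auto
  with mixture show "AE x in \<nu>. kernel_op K f x = avg f x"
    by eventually_elim (simp add: avg_def)
qed

lemma integral_mult_avg:
  assumes f: "f \<in> L2 \<nu>" and g: "g \<in> L2 \<nu>"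
  shows "(\<integral>x. f x * avg g x \<partial>\<nu>)
    = (\<Sum>a\<in>A. \<integral>x. kernel_op (Q a) f x * kernel_op (Q a) g x \<partial>\<nu>) / real (card A)"
proof -
  have "(\<integral>x. f x * avg g x \<partial>\<nu>) = (\<integral>x. (\<Sum>a\<in>A. f x * kernel_op (Q a) g x) / real (card A) \<partial>\<nu>)"
    by (simp add: avg_def sum_distrib_left)
  also have "\<dots> = (\<Sum>a\<in>A. \<integral>x. f x * kernel_op (Q a) g x \<partial>\<nu>) / real (card A)"
    using kernel_op_L2[OF g] L2_mult[OF f] by (simp add: Bochner_Integration.integral_sum)
  also have "\<dots> = (\<Sum>a\<in>A. \<integral>x. kernel_op (Q a) f x * kernel_op (Q a) g x \<partial>\<nu>) / real (card A)"
    using projection_kernel.kernel_op_projection[OF proj f g] by simp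
  finally show ?thesis .
qed

lemma integral_mult_avg_self:
  assumes f: "f \<in> L2 \<nu>"
  shows "(\<integral>x. f x * avg f x \<partial>\<nu>) = (\<Sum>a\<in>A. \<integral>x. (kernel_op (Q a) f x)\<^sup>2 \<partial>\<nu>) / real (card A)"
  using integral_mult_avg[OF f f] by (simp add: power2_eq_square)

lemma dirichlet_form_eq:
  assumes f: "f \<in> L2 \<nu>"
  shows "dirichlet_form \<nu> A Q f = (\<integral>x. (f x)\<^sup>2 \<partial>\<nu>) - (\<integral>x. f x * avg f x \<partial>\<nu>)"
  using card_pos
  by (simp add: dirichlet_form_def integral_mult_avg_self[OF f] sum_subtractf diff_divide_distrib)

lemma integral_mult_avg_le:
  assumes f: "f \<in> L2 \<nu>"
  shows "(\<integral>x. f x * avg f x \<partial>\<nu>) \<le> (\<integral>x. (f x)\<^sup>2 \<partial>\<nu>)"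
proof -
  have "(\<Sum>a\<in>A. \<integral>x. (kernel_op (Q a) f x)\<^sup>2 \<partial>\<nu>) \<le> (\<Sum>a\<in>A. \<integral>x. (f x)\<^sup>2 \<partial>\<nu>)"
    using projection_kernel.kernel_op_contraction[OF proj f] by (rule sum_mono)
  then show ?thesis
    using card_pos by (simp add: integral_mult_avg_self[OF f] pos_divide_le_eq mult.commute)
qed

text \<open>
  A bound on the quadratic form of the positive operator \<open>avg\<close> at \<open>f\<close> and at \<open>avg f\<close> bounds
  the norm of \<open>avg f\<close>: the Cauchy-Schwarz inequality for the positive form
  \<open>(u, v) \<mapsto> \<langle>u, avg v\<rangle>\<close>, in its weighted additive version, applied to \<open>f\<close> and \<open>avg f\<close>.
\<close>

lemma square_avg_le:
  assumes f: "f \<in> L2 \<nu>" and c: "0 \<le> c"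
    and 1: "(\<integral>x. f x * avg f x \<partial>\<nu>) \<le> c * (\<integral>x. (f x)\<^sup>2 \<partial>\<nu>)"
    and 2: "(\<integral>x. avg f x * avg (avg f) x \<partial>\<nu>) \<le> c * (\<integral>x. (avg f x)\<^sup>2 \<partial>\<nu>)"
  shows "(\<integral>x. (avg f x)\<^sup>2 \<partial>\<nu>) \<le> c\<^sup>2 * (\<integral>x. (f x)\<^sup>2 \<partial>\<nu>)"
proof -
  let ?N = "real (card A)"
  note g = avg_L2[OF f]
  have cross: "2 * (\<integral>x. (avg f x)\<^sup>2 \<partial>\<nu>)
      \<le> t * (\<integral>x. f x * avg f x \<partial>\<nu>) + (\<integral>x. avg f x * avg (avg f) x \<partial>\<nu>) / t" if t: "0 < t" for t
  proof -
    have "2 * (\<integral>x. (avg f x)\<^sup>2 \<partial>\<nu>)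
        = (\<Sum>a\<in>A. 2 * (\<integral>x. kernel_op (Q a) f x * kernel_op (Q a) (avg f) x \<partial>\<nu>)) / ?N"
      using integral_mult_avg[OF g f] by (simp add: power2_eq_square sum_distrib_left mult.commute)
    also have "\<dots> \<le> (\<Sum>a\<in>A. t * (\<integral>x. (kernel_op (Q a) f x)\<^sup>2 \<partial>\<nu>)
        + (\<integral>x. (kernel_op (Q a) (avg f) x)\<^sup>2 \<partial>\<nu>) / t) / ?N"
      using t f g by (intro divide_right_mono sum_mono L2_cross_le kernel_op_L2) auto
    also have "\<dots> = t * (\<integral>x. f x * avg f x \<partial>\<nu>) + (\<integral>x. avg f x * avg (avg f) x \<partial>\<nu>) / t"
      by (simp add: integral_mult_avg_self f g sum.distrib sum_distrib_left sum_divide_distrib add_divide_distrib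
           mult.commute)
    finally show ?thesis .
  qed
  show ?thesis
  proof (cases "c = 0")
    case True
    then show ?thesis using cross[of 1] 1 2 by simp
  next
    case False
    with c have c: "0 < c" by simp
    have "2 * (\<integral>x. (avg f x)\<^sup>2 \<partial>\<nu>)
        \<le> c * (c * (\<integral>x. (f x)\<^sup>2 \<partial>\<nu>)) + (c * (\<integral>x. (avg f x)\<^sup>2 \<partial>\<nu>)) / c"
      using c 1 2 by (intro order_trans[OF cross[OF c]] add_mono mult_left_mono divide_right_mono) auto
    then show ?thesis using c by (simp add: power2_eq_square)
  qed
qed

lemma l2_norm_avg_le:
  assumes f: "f \<in> L2 \<nu>" and c: "0 \<le> c"
    and 1: "(\<integral>x. f x * avg f x \<partial>\<nu>) \<le> c * (\<integral>x. (f x)\<^sup>2 \<partial>\<nu>)"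
    and 2: "(\<integral>x. avg f x * avg (avg f) x \<partial>\<nu>) \<le> c * (\<integral>x. (avg f x)\<^sup>2 \<partial>\<nu>)"
  shows "l2_norm \<nu> (avg f) \<le> c * l2_norm \<nu> f"
proof (rule power2_le_imp_le)
  show "(l2_norm \<nu> (avg f))\<^sup>2 \<le> (c * l2_norm \<nu> f)\<^sup>2"
    using square_avg_le[OF assms] by (simp add: power_mult_distrib l2_norm_L2 f avg_L2)
qed (use c in \<open>simp add: l2_norm_nonneg\<close>)

lemma l2_norm_avg_contraction:
  assumes f: "f \<in> L2 \<nu>"
  shows "l2_norm \<nu> (avg f) \<le> l2_norm \<nu> f"
  using l2_norm_avg_le[OF f, of 1] integral_mult_avg_le f avg_L2 by simp

lemma integral_avg:
  assumes f: "f \<in> L2 \<nu>"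
  shows "(\<integral>x. avg f x \<partial>\<nu>) = (\<integral>x. f x \<partial>\<nu>)"
proof -
  have "(\<integral>x. avg f x \<partial>\<nu>) = (\<Sum>a\<in>A. \<integral>x. kernel_op (Q a) f x \<partial>\<nu>) / real (card A)"
    using kernel_op_L2[OF f] L2_integrable
    by (simp add: avg_def Bochner_Integration.integral_sum)
  then show ?thesis
    using projection_kernel.integral_kernel_op[OF proj L2_integrable[OF f]] card_pos by simp
qed

lemma quotients_bounded:
  assumes "q \<in> insert 0 {l2_norm \<nu> (kernel_op K f) / l2_norm \<nu> f | f. f \<in> L20 \<nu> \<and> l2_norm \<nu> f \<noteq> 0}"
  shows "q \<le> 1"
proof -
  have "l2_norm \<nu> (kernel_op K f) / l2_norm \<nu> f \<le> 1" if "f \<in> L20 \<nu>" "l2_norm \<nu> f \<noteq> 0" for f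
    using that l2_norm_avg_contraction[of f] l2_norm_nonneg[of \<nu> f]
    by (simp add: L20_L2 l2_norm_mixture)
  then show ?thesis using assms by auto
qed

lemma spectral_gap_le_1: "spectral_gap \<nu> K \<le> 1"
proof -
  have "0 \<le> kernel_norm \<nu> K"
    unfolding kernel_norm_def by (rule cSup_upper) (auto intro!: bdd_aboveI[of _ 1] quotients_bounded)
  then show ?thesis by (simp add: spectral_gap_def)
qed

lemma spectral_gap_nonneg: "0 \<le> spectral_gap \<nu> K"
proof -
  have "kernel_norm \<nu> K \<le> 1"
    unfolding kernel_norm_def by (rule cSup_least) (auto intro!: quotients_bounded)
  then show ?thesis by (simp add: spectral_gap_def)
qed

lemma integral_mult_avg_gap:
  assumes f: "f \<in> L20 \<nu>"
  shows "(\<integral>x. f x * avg f x \<partial>\<nu>) \<le> (1 - spectral_gap \<nu> K) * (\<integral>x. (f x)\<^sup>2 \<partial>\<nu>)"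
proof -
  have f2: "f \<in> L2 \<nu>" using f by (simp add: L20_L2)
  have "l2_norm \<nu> (avg f) \<le> kernel_norm \<nu> K * l2_norm \<nu> f"
  proof (cases "l2_norm \<nu> f = 0")
    case True
    then show ?thesis using l2_norm_avg_contraction[OF f2] by simp
  next
    case False
    have "l2_norm \<nu> (kernel_op K f) / l2_norm \<nu> f \<le> kernel_norm \<nu> K"
      unfolding kernel_norm_def
      by (rule cSup_upper) (use f False in \<open>auto intro!: bdd_aboveI[of _ 1] quotients_bounded\<close>)
    then show ?thesis
      using False l2_norm_nonneg[of \<nu> f] by (simp add: l2_norm_mixture[OF f2] pos_divide_le_eq)
  qed
  then have "l2_norm \<nu> f * l2_norm \<nu> (avg f) \<le> l2_norm \<nu> f * (kernel_norm \<nu> K * l2_norm \<nu> f)"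
    using l2_norm_nonneg by (rule mult_left_mono)
  also have "\<dots> = (1 - spectral_gap \<nu> K) * (l2_norm \<nu> f)\<^sup>2"
    by (simp add: spectral_gap_def power2_eq_square)
  finally show ?thesis
    using L2_Cauchy_Schwarz[OF f2 avg_L2[OF f2]] by (simp add: l2_norm_L2 f2)
qed

text \<open>On mean-zero functions the inequality is \<open>\<langle>f, K f\<rangle> \<le> \<parallel>f\<parallel> \<parallel>K f\<parallel> \<le> \<parallel>K\<parallel> \<parallel>f\<parallel>\<^sup>2\<close>; both sides are
  unchanged when a constant is subtracted from \<open>f\<close>.\<close>

lemma poincare_spectral_gap: "poincare \<nu> A Q (spectral_gap \<nu> K)"
  unfolding poincare_def
proof
  fix f assume f: "f \<in> L2 \<nu>"
  let ?m = "expectation f"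
  define f0 where "f0 = (\<lambda>x. f x + - ?m)"
  have f0: "f0 \<in> L2 \<nu>" unfolding f0_def by (rule L2_add[OF f L2_const])
  have f0_sq: "(\<integral>x. (f0 x)\<^sup>2 \<partial>\<nu>) = (\<integral>x. (f x)\<^sup>2 \<partial>\<nu>) - ?m\<^sup>2"
    using variance_eq[OF L2_integrable[OF f] L2_square[OF f]] by (simp add: f0_def)
  have "f0 \<in> L20 \<nu>"
    using f0 L2_integrable[OF f] by (simp add: L20_L2 f0_def prob_space)
  from integral_mult_avg_gap[OF this]
  have "spectral_gap \<nu> K * (\<integral>x. (f0 x)\<^sup>2 \<partial>\<nu>) \<le> dirichlet_form \<nu> A Q f0"
    by (simp add: dirichlet_form_eq[OF f0] algebra_simps)
  also have "dirichlet_form \<nu> A Q f0 = dirichlet_form \<nu> A Q f"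
  proof -
    have "(\<integral>x. (kernel_op (Q a) f0 x)\<^sup>2 \<partial>\<nu>) = (\<integral>x. (kernel_op (Q a) f x)\<^sup>2 \<partial>\<nu>) - ?m\<^sup>2" if a: "a \<in> A" for a
    proof -
      interpret a: projection_kernel \<nu> "Q a" using a by (rule proj)
      note Pf = a.kernel_op_L2[OF f]
      have [measurable]: "f \<in> borel_measurable \<nu>" "f0 \<in> borel_measurable \<nu>"
        using f f0 by (auto simp: L2_measurable)
      have "(\<integral>x. (kernel_op (Q a) f0 x)\<^sup>2 \<partial>\<nu>) = (\<integral>x. (kernel_op (Q a) f x - ?m)\<^sup>2 \<partial>\<nu>)"
      proof (rule integral_cong_AE)
        show "AE x in \<nu>. (kernel_op (Q a) f0 x)\<^sup>2 = (kernel_op (Q a) f x - ?m)\<^sup>2"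
          using a.AE_integrable_kernel[OF L2_integrable[OF f]] AE_space
        proof eventually_elim
          case (elim x)
          interpret x: prob_space "Q a x" using elim(2) by (rule a.kernel_prob)
          show ?case using elim(1) by (simp add: kernel_op_def f0_def x.prob_space)
        qed
      qed measurable
      also have "\<dots> = (\<integral>x. (kernel_op (Q a) f x)\<^sup>2 \<partial>\<nu>) - ?m\<^sup>2"
        using variance_eq[OF L2_integrable[OF Pf] L2_square[OF Pf]] a.integral_kernel_op[OF L2_integrable[OF f]]
        by simp
      finally show ?thesis .
    qed
    then show ?thesis by (simp add: dirichlet_form_def f0_sq)
  qed
  finally show "spectral_gap \<nu> K * ((\<integral>x. (f x)\<^sup>2 \<partial>\<nu>) - ?m\<^sup>2) \<le> dirichlet_form \<nu> A Q f"
    by (simp add: f0_sq)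
qed

text \<open>Conversely, a Poincare constant is a lower bound for the spectral gap, by
  \<open>l2_norm_avg_le\<close>. The condition \<open>g \<le> 1\<close> is needed when \<open>L20 \<nu>\<close> is trivial: then every
  \<open>g\<close> is a Poincare constant, whereas the spectral gap is \<open>1\<close>.\<close>

lemma spectral_gap_greatest:
  assumes "poincare \<nu> A Q g" and g: "g \<le> 1"
  shows "g \<le> spectral_gap \<nu> K"
proof -
  have *: "(\<integral>x. f x * avg f x \<partial>\<nu>) \<le> (1 - g) * (\<integral>x. (f x)\<^sup>2 \<partial>\<nu>)" if f: "f \<in> L20 \<nu>" for f
  proof -
    have "f \<in> L2 \<nu>" "expectation f = 0" using f by (auto simp: L20_L2)
    with bspec[OF assms(1)[unfolded poincare_def] this(1)] show ?thesis
      by (simp add: dirichlet_form_eq algebra_simps)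
  qed
  have "kernel_norm \<nu> K \<le> 1 - g"
    unfolding kernel_norm_def
  proof (rule cSup_least)
    fix q assume "q \<in> insert 0 {l2_norm \<nu> (kernel_op K f) / l2_norm \<nu> f | f. f \<in> L20 \<nu> \<and> l2_norm \<nu> f \<noteq> 0}"
    then consider "q = 0"
      | f where "q = l2_norm \<nu> (kernel_op K f) / l2_norm \<nu> f" "f \<in> L20 \<nu>" "l2_norm \<nu> f \<noteq> 0"
      by auto
    then show "q \<le> 1 - g"
    proof cases
      case 1
      then show ?thesis using g by simp
    next
      case (2 f)
      have f: "f \<in> L2 \<nu>" using 2 by (simp add: L20_L2)
      have "avg f \<in> L20 \<nu>" using 2 by (simp add: L20_L2 avg_L2 integral_avg)
      then have "l2_norm \<nu> (avg f) \<le> (1 - g) * l2_norm \<nu> f"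
        using g f 2 by (intro l2_norm_avg_le *) auto
      then show ?thesis
        using 2 l2_norm_nonneg[of \<nu> f] by (simp add: l2_norm_mixture[OF f] pos_divide_le_eq)
    qed
  qed auto
  then show ?thesis by (simp add: spectral_gap_def)
qed

end

lemma poincare_mono:
  assumes "prob_space \<nu>" "poincare \<nu> A Q g" "g' \<le> g"
  shows "poincare \<nu> A Q g'"
  unfolding poincare_def
proof
  fix f assume f: "f \<in> L2 \<nu>"
  have "g' * ((\<integral>x. (f x)\<^sup>2 \<partial>\<nu>) - (\<integral>x. f x \<partial>\<nu>)\<^sup>2) \<le> g * ((\<integral>x. (f x)\<^sup>2 \<partial>\<nu>) - (\<integral>x. f x \<partial>\<nu>)\<^sup>2)"
    using assms(3) prob_space.L2_square_expectation_le[OF assms(1) f] by (intro mult_right_mono) auto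
  then show "g' * ((\<integral>x. (f x)\<^sup>2 \<partial>\<nu>) - (\<integral>x. f x \<partial>\<nu>)\<^sup>2) \<le> dirichlet_form \<nu> A Q f"
    using assms(2) f unfolding poincare_def by force
qed

section \<open>Redrawing blocks of a product density\<close>

text \<open>The point \<open>z\<close> of the product over \<open>J\<close> with its coordinates in \<open>\<Gamma>\<close> replaced by \<open>w\<close>.
  Only the coordinates of \<open>z\<close> in \<open>J - \<Gamma>\<close> matter.\<close>

definition redraw :: "'i set \<Rightarrow> 'i set \<Rightarrow> ('i \<Rightarrow> 'a) \<Rightarrow> ('i \<Rightarrow> 'a) \<Rightarrow> 'i \<Rightarrow> 'a" where
  "redraw J \<Gamma> z w = merge \<Gamma> (J - \<Gamma>) (w, z)"

lemma redraw_redraw: "redraw J \<Gamma> (redraw J \<Gamma> z w) w' = redraw J \<Gamma> z w'"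
  by (auto simp: redraw_def merge_def fun_eq_iff)

lemma redraw_nested:
  assumes "\<Gamma> \<subseteq> \<Delta>" "\<Delta> \<subseteq> J"
  shows "redraw J \<Gamma> (redraw J \<Delta> z w) u = redraw J \<Delta> z (redraw \<Delta> \<Gamma> w u)"
  using assms by (auto simp: redraw_def merge_def fun_eq_iff)

lemma measurable_redraw_pair:
  assumes "\<Gamma> \<subseteq> J"
  shows "(\<lambda>(z, w). redraw J \<Gamma> z w) \<in> Pi\<^sub>M J M \<Otimes>\<^sub>M Pi\<^sub>M \<Gamma> M \<rightarrow>\<^sub>M Pi\<^sub>M J M"
proof -
  have J: "\<Gamma> \<union> (J - \<Gamma>) = J" using assms by auto
  have r: "(\<lambda>z. restrict z (J - \<Gamma>)) \<in> Pi\<^sub>M J M \<rightarrow>\<^sub>M Pi\<^sub>M (J - \<Gamma>) M"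
    by (rule measurable_restrict_subset) auto
  have "(\<lambda>x. merge \<Gamma> (J - \<Gamma>) (snd x, restrict (fst x) (J - \<Gamma>)))
      \<in> Pi\<^sub>M J M \<Otimes>\<^sub>M Pi\<^sub>M \<Gamma> M \<rightarrow>\<^sub>M Pi\<^sub>M (\<Gamma> \<union> (J - \<Gamma>)) M"
    using r by measurable
  then show ?thesis unfolding J by (simp add: redraw_def[abs_def] case_prod_beta)
qed

lemma measurable_redraw:
  assumes "\<Gamma> \<subseteq> J" "z \<in> space (Pi\<^sub>M J M)"
  shows "redraw J \<Gamma> z \<in> Pi\<^sub>M \<Gamma> M \<rightarrow>\<^sub>M Pi\<^sub>M J M"
  using measurable_compose[OF measurable_Pair1'[OF assms(2)] measurable_redraw_pair[OF assms(1)]] by simp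

lemma redraw_space:
  "\<Gamma> \<subseteq> J \<Longrightarrow> z \<in> space (Pi\<^sub>M J M) \<Longrightarrow> w \<in> space (Pi\<^sub>M \<Gamma> M) \<Longrightarrow> redraw J \<Gamma> z w \<in> space (Pi\<^sub>M J M)"
  using measurable_space[OF measurable_redraw] by blast

text \<open>
  The marginal at \<open>z\<close> of the density \<open>h\<close> on the coordinates outside \<open>\<Gamma>\<close>, obtained by
  integrating out the block \<open>\<Gamma>\<close>. As a Bochner integral it is \<open>0\<close> where the integral diverges.
\<close>

definition block_mass :: "('i \<Rightarrow> 'a measure) \<Rightarrow> 'i set \<Rightarrow> 'i set \<Rightarrow> (('i \<Rightarrow> 'a) \<Rightarrow> real) \<Rightarrow> ('i \<Rightarrow> 'a) \<Rightarrow> real" where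
  "block_mass M J \<Gamma> h z = (\<integral>w. h (redraw J \<Gamma> z w) \<partial>Pi\<^sub>M \<Gamma> M)"

text \<open>The conditional density of the block \<open>\<Gamma>\<close> given the coordinates of \<open>z\<close> outside it.\<close>

definition block_density ::
    "('i \<Rightarrow> 'a measure) \<Rightarrow> 'i set \<Rightarrow> 'i set \<Rightarrow> (('i \<Rightarrow> 'a) \<Rightarrow> real) \<Rightarrow> ('i \<Rightarrow> 'a) \<Rightarrow> ('i \<Rightarrow> 'a) \<Rightarrow> real" where
  "block_density M J \<Gamma> h z w = h (redraw J \<Gamma> z w) / block_mass M J \<Gamma> h z"

text \<open>
  Redraw the block \<open>\<Gamma>\<close> from its conditional law. Where that law is undefined the point is left
  in place. This choice makes \<open>resample_nested\<close> hold for every \<open>w\<close>, not only almost everywhere.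
\<close>

definition resample ::
    "('i \<Rightarrow> 'a measure) \<Rightarrow> 'i set \<Rightarrow> 'i set \<Rightarrow> (('i \<Rightarrow> 'a) \<Rightarrow> real) \<Rightarrow> ('i \<Rightarrow> 'a) \<Rightarrow> ('i \<Rightarrow> 'a) measure" where
  "resample M J \<Gamma> h z =
     (if 0 < block_mass M J \<Gamma> h z
      then distr (density (Pi\<^sub>M \<Gamma> M) (\<lambda>w. ennreal (block_density M J \<Gamma> h z w))) (Pi\<^sub>M J M) (redraw J \<Gamma> z)
      else return (Pi\<^sub>M J M) z)"

lemma block_mass_redraw: "block_mass M J \<Gamma> h (redraw J \<Gamma> z w) = block_mass M J \<Gamma> h z"
  by (simp add: block_mass_def redraw_redraw)

lemma block_density_redraw: "block_density M J \<Gamma> h (redraw J \<Gamma> z w) = block_density M J \<Gamma> h z"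
  by (simp add: block_density_def fun_eq_iff redraw_redraw block_mass_redraw)

lemma resample_redraw:
  assumes "0 < block_mass M J \<Gamma> h z"
  shows "resample M J \<Gamma> h (redraw J \<Gamma> z w) = resample M J \<Gamma> h z"
proof -
  have "redraw J \<Gamma> (redraw J \<Gamma> z w) = redraw J \<Gamma> z"
    by (rule ext) (rule redraw_redraw)
  then show ?thesis
    unfolding resample_def block_mass_redraw block_density_redraw using assms by simp
qed

lemma redraw_restrict: "redraw J \<Gamma> (restrict x (J - \<Gamma>)) w = redraw J \<Gamma> x w"
  by (simp add: redraw_def)

lemma block_mass_restrict: "block_mass M J \<Gamma> h (restrict x (J - \<Gamma>)) = block_mass M J \<Gamma> h x"
  by (simp add: block_mass_def redraw_restrict)

lemma block_density_restrict: "block_density M J \<Gamma> h (restrict x (J - \<Gamma>)) = block_density M J \<Gamma> h x"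
  by (simp add: block_density_def block_mass_restrict redraw_restrict fun_eq_iff)

text \<open>
  Only the factors in the index set are assumed to be \<open>\<sigma>\<close>-finite. In the next two proofs the
  other factors, which are irrelevant, are replaced by a one-point space, so that the results of
  the locale \<open>product_sigma_finite\<close> apply.
\<close>

lemma sigma_finite_PiM:
  fixes M :: "'i \<Rightarrow> 'a measure"
  assumes "finite \<Gamma>" "\<And>i. i \<in> \<Gamma> \<Longrightarrow> sigma_finite_measure (M i)"
  shows "sigma_finite_measure (Pi\<^sub>M \<Gamma> M)"
proof -
  define M' where "M' i = (if i \<in> \<Gamma> then M i else count_space {undefined})" for i
  interpret product_sigma_finite M'
    by (rule product_sigma_finite.intro) (simp add: M'_def assms(2) sigma_finite_measure_count_space_finite)
  interpret finite_product_sigma_finite M' \<Gamma> by standard fact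
  have "Pi\<^sub>M \<Gamma> M = Pi\<^sub>M \<Gamma> M'" by (rule PiM_cong) (auto simp: M'_def)
  then show ?thesis using sigma_finite_measure_axioms by (rule ssubst)
qed

lemma nn_integral_PiM_redraw:
  fixes M :: "'i \<Rightarrow> 'a measure"
  assumes J: "finite J" "\<And>i. i \<in> J \<Longrightarrow> sigma_finite_measure (M i)" "\<Gamma> \<subseteq> J"
    and f: "f \<in> borel_measurable (Pi\<^sub>M J M)"
  shows "(\<integral>\<^sup>+z. f z \<partial>Pi\<^sub>M J M) = (\<integral>\<^sup>+u. \<integral>\<^sup>+w. f (redraw J \<Gamma> u w) \<partial>Pi\<^sub>M \<Gamma> M \<partial>Pi\<^sub>M (J - \<Gamma>) M)"
proof -
  define M' where "M' i = (if i \<in> J then M i else count_space {undefined})" for i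
  interpret product_sigma_finite M'
    by (rule product_sigma_finite.intro) (simp add: M'_def J(2) sigma_finite_measure_count_space_finite)
  have eq: "Pi\<^sub>M I M = Pi\<^sub>M I M'" if "I \<subseteq> J" for I
    using that by (intro PiM_cong) (auto simp: M'_def)
  have "(\<integral>\<^sup>+z. f z \<partial>Pi\<^sub>M ((J - \<Gamma>) \<union> \<Gamma>) M')
      = (\<integral>\<^sup>+u. \<integral>\<^sup>+w. f (merge (J - \<Gamma>) \<Gamma> (u, w)) \<partial>Pi\<^sub>M \<Gamma> M' \<partial>Pi\<^sub>M (J - \<Gamma>) M')"
    using J f unfolding eq[OF order_refl]
    by (intro product_nn_integral_fold) (auto simp: Un_absorb2 finite_subset)
  moreover have "merge (J - \<Gamma>) \<Gamma> (u, w) = redraw J \<Gamma> u w" for u w :: "'i \<Rightarrow> 'a"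
    unfolding redraw_def by (rule merge_commute) auto
  ultimately show ?thesis
    using J by (simp add: Un_absorb2 eq)
qed

text \<open>A probability density \<open>h\<close> on a finite product of \<open>\<sigma>\<close>-finite measure spaces.\<close>

locale product_density =
  fixes M :: "'i \<Rightarrow> 'a measure" and J :: "'i set" and h :: "('i \<Rightarrow> 'a) \<Rightarrow> real"
  assumes finite_J: "finite J"
    and sigma_finite_factor: "i \<in> J \<Longrightarrow> sigma_finite_measure (M i)"
    and h_measurable[measurable]: "h \<in> borel_measurable (Pi\<^sub>M J M)"
    and h_nonneg: "z \<in> space (Pi\<^sub>M J M) \<Longrightarrow> 0 \<le> h z"
    and h_total: "(\<integral>\<^sup>+z. ennreal (h z) \<partial>Pi\<^sub>M J M) = 1"
begin

abbreviation \<nu> :: "('i \<Rightarrow> 'a) measure" where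
  "\<nu> \<equiv> density (Pi\<^sub>M J M) (\<lambda>z. ennreal (h z))"

lemma prob_space_\<nu>: "prob_space \<nu>"
  by (rule prob_spaceI) (simp add: emeasure_density h_total cong: nn_integral_cong)

lemma sigma_finite_block: "\<Gamma> \<subseteq> J \<Longrightarrow> sigma_finite_measure (Pi\<^sub>M \<Gamma> M)"
  using finite_J sigma_finite_factor by (intro sigma_finite_PiM) (auto simp: finite_subset)

lemma measurable_block_mass:
  assumes "\<Gamma> \<subseteq> J"
  shows "block_mass M J \<Gamma> h \<in> borel_measurable (Pi\<^sub>M J M)"
proof -
  interpret sigma_finite_measure "Pi\<^sub>M \<Gamma> M" using assms by (rule sigma_finite_block)
  note [measurable] = measurable_redraw_pair[OF assms]
  show ?thesis
    unfolding block_mass_def[abs_def] by measurable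
qed

lemma measurable_block_density:
  assumes "\<Gamma> \<subseteq> J"
  shows "(\<lambda>(z, w). block_density M J \<Gamma> h z w) \<in> borel_measurable (Pi\<^sub>M J M \<Otimes>\<^sub>M Pi\<^sub>M \<Gamma> M)"
proof -
  note [measurable] = measurable_redraw_pair[OF assms] measurable_block_mass[OF assms]
  show ?thesis unfolding block_density_def by measurable
qed

lemma nn_integral_block:
  assumes \<Gamma>: "\<Gamma> \<subseteq> J" and z: "z \<in> space (Pi\<^sub>M J M)" and pos: "0 < block_mass M J \<Gamma> h z"
  shows "(\<integral>\<^sup>+w. ennreal (h (redraw J \<Gamma> z w)) \<partial>Pi\<^sub>M \<Gamma> M) = ennreal (block_mass M J \<Gamma> h z)"
proof -
  have "integrable (Pi\<^sub>M \<Gamma> M) (\<lambda>w. h (redraw J \<Gamma> z w))"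
    using pos not_integrable_integral_eq unfolding block_mass_def by fastforce
  then show ?thesis
    unfolding block_mass_def using \<Gamma> z
    by (intro nn_integral_eq_integral) (auto intro!: AE_I2 h_nonneg redraw_space)
qed

lemma product_density_block:
  assumes \<Gamma>: "\<Gamma> \<subseteq> J" and z: "z \<in> space (Pi\<^sub>M J M)" and pos: "0 < block_mass M J \<Gamma> h z"
  shows "product_density M \<Gamma> (block_density M J \<Gamma> h z)"
proof (rule product_density.intro)
  note [measurable] = measurable_redraw[OF \<Gamma> z]
  show "finite \<Gamma>" using \<Gamma> finite_J by (rule finite_subset)
  show "\<And>i. i \<in> \<Gamma> \<Longrightarrow> sigma_finite_measure (M i)" using \<Gamma> sigma_finite_factor by auto
  show "block_density M J \<Gamma> h z \<in> borel_measurable (Pi\<^sub>M \<Gamma> M)"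
    unfolding block_density_def[abs_def] by measurable
  show "\<And>w. w \<in> space (Pi\<^sub>M \<Gamma> M) \<Longrightarrow> 0 \<le> block_density M J \<Gamma> h z w"
    unfolding block_density_def using pos \<Gamma> z by (auto intro!: divide_nonneg_pos h_nonneg redraw_space)
  have "(\<integral>\<^sup>+w. ennreal (block_density M J \<Gamma> h z w) \<partial>Pi\<^sub>M \<Gamma> M)
      = (\<integral>\<^sup>+w. ennreal (h (redraw J \<Gamma> z w)) / ennreal (block_mass M J \<Gamma> h z) \<partial>Pi\<^sub>M \<Gamma> M)"
    unfolding block_density_def using pos \<Gamma> z
    by (intro nn_integral_cong) (simp add: divide_ennreal h_nonneg redraw_space)
  also have "\<dots> = ennreal (block_mass M J \<Gamma> h z) / ennreal (block_mass M J \<Gamma> h z)"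
    by (simp add: nn_integral_divide nn_integral_block[OF assms])
  also have "\<dots> = 1"
    using pos by (simp add: divide_ennreal)
  finally show "(\<integral>\<^sup>+w. ennreal (block_density M J \<Gamma> h z w) \<partial>Pi\<^sub>M \<Gamma> M) = 1" .
qed

lemma prob_space_resample:
  assumes \<Gamma>: "\<Gamma> \<subseteq> J" and z: "z \<in> space (Pi\<^sub>M J M)"
  shows "prob_space (resample M J \<Gamma> h z)"
proof (cases "0 < block_mass M J \<Gamma> h z")
  case True
  interpret z: product_density M \<Gamma> "block_density M J \<Gamma> h z"
    using assms True by (rule product_density_block)
  show ?thesis
    using True prob_space.prob_space_distr[OF z.prob_space_\<nu>, of "redraw J \<Gamma> z" "Pi\<^sub>M J M"] measurable_redraw[OF assms]
    by (simp add: resample_def)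
next
  case False
  then show ?thesis using z by (simp add: resample_def prob_space_return)
qed

lemma nn_integral_resample:
  assumes \<Gamma>: "\<Gamma> \<subseteq> J" and z: "z \<in> space (Pi\<^sub>M J M)" and g[measurable]: "g \<in> borel_measurable (Pi\<^sub>M J M)"
  shows "(\<integral>\<^sup>+x. g x \<partial>resample M J \<Gamma> h z) =
    (if 0 < block_mass M J \<Gamma> h z
     then (\<integral>\<^sup>+w. ennreal (block_density M J \<Gamma> h z w) * g (redraw J \<Gamma> z w) \<partial>Pi\<^sub>M \<Gamma> M) else g z)"
proof (cases "0 < block_mass M J \<Gamma> h z")
  case True
  interpret z: product_density M \<Gamma> "block_density M J \<Gamma> h z"
    using \<Gamma> z True by (rule product_density_block)
  note [measurable] = measurable_redraw[OF \<Gamma> z]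
  show ?thesis using True
    by (simp add: resample_def nn_integral_distr nn_integral_density)
next
  case False
  then show ?thesis using z by (simp add: resample_def nn_integral_return)
qed

lemma measurable_resample:
  assumes \<Gamma>: "\<Gamma> \<subseteq> J"
  shows "resample M J \<Gamma> h \<in> Pi\<^sub>M J M \<rightarrow>\<^sub>M prob_algebra (Pi\<^sub>M J M)"
proof (rule measurable_prob_algebraI)
  fix z assume "z \<in> space (Pi\<^sub>M J M)"
  then show "prob_space (resample M J \<Gamma> h z)" using \<Gamma> by (intro prob_space_resample)
next
  show "resample M J \<Gamma> h \<in> Pi\<^sub>M J M \<rightarrow>\<^sub>M subprob_algebra (Pi\<^sub>M J M)"
  proof (rule measurable_subprob_algebra)
    fix z assume "z \<in> space (Pi\<^sub>M J M)"
    then show "subprob_space (resample M J \<Gamma> h z)"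
      using \<Gamma> by (intro prob_space_imp_subprob_space prob_space_resample)
    show "sets (resample M J \<Gamma> h z) = sets (Pi\<^sub>M J M)" by (simp add: resample_def)
  next
    fix A assume A[measurable]: "A \<in> sets (Pi\<^sub>M J M)"
    interpret sigma_finite_measure "Pi\<^sub>M \<Gamma> M" using \<Gamma> by (rule sigma_finite_block)
    note [measurable] = measurable_redraw_pair[OF \<Gamma>] measurable_block_mass[OF \<Gamma>] measurable_block_density[OF \<Gamma>]
    have "(\<lambda>z. if 0 < block_mass M J \<Gamma> h z
        then (\<integral>\<^sup>+w. ennreal (block_density M J \<Gamma> h z w) * indicator A (redraw J \<Gamma> z w) \<partial>Pi\<^sub>M \<Gamma> M)
        else indicator A z) \<in> borel_measurable (Pi\<^sub>M J M)"
      by measurable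
    also have "?this \<longleftrightarrow> (\<lambda>z. emeasure (resample M J \<Gamma> h z) A) \<in> borel_measurable (Pi\<^sub>M J M)"
    proof (rule measurable_cong)
      fix z assume z: "z \<in> space (Pi\<^sub>M J M)"
      have "A \<in> sets (resample M J \<Gamma> h z)" using A by (simp add: resample_def)
      then have "emeasure (resample M J \<Gamma> h z) A = (\<integral>\<^sup>+x. indicator A x \<partial>resample M J \<Gamma> h z)"
        by simp
      then show "(if 0 < block_mass M J \<Gamma> h z
        then (\<integral>\<^sup>+w. ennreal (block_density M J \<Gamma> h z w) * indicator A (redraw J \<Gamma> z w) \<partial>Pi\<^sub>M \<Gamma> M)
        else indicator A z) = emeasure (resample M J \<Gamma> h z) A"
        using nn_integral_resample[OF \<Gamma> z, of "indicator A"] A by simp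
    qed
    finally show "(\<lambda>z. emeasure (resample M J \<Gamma> h z) A) \<in> borel_measurable (Pi\<^sub>M J M)" .
  qed
qed

text \<open>For almost every configuration outside the block, either the conditional density exists or
  the joint density vanishes almost everywhere along the block. Divergence of the marginal is
  excluded because \<open>h\<close> is integrable.\<close>

lemma AE_block_mass_zero:
  assumes \<Gamma>: "\<Gamma> \<subseteq> J"
  shows "AE u in Pi\<^sub>M (J - \<Gamma>) M. 0 < block_mass M J \<Gamma> h u \<or> (AE w in Pi\<^sub>M \<Gamma> M. h (redraw J \<Gamma> u w) = 0)"
proof -
  have un: "\<Gamma> \<union> (J - \<Gamma>) = J" using \<Gamma> by auto
  interpret sigma_finite_measure "Pi\<^sub>M \<Gamma> M" using \<Gamma> by (rule sigma_finite_block)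
  have r: "(\<lambda>(u, w). redraw J \<Gamma> u w) \<in> Pi\<^sub>M (J - \<Gamma>) M \<Otimes>\<^sub>M Pi\<^sub>M \<Gamma> M \<rightarrow>\<^sub>M Pi\<^sub>M J M"
  proof -
    have "(\<lambda>x. merge \<Gamma> (J - \<Gamma>) (snd x, fst x))
        \<in> Pi\<^sub>M (J - \<Gamma>) M \<Otimes>\<^sub>M Pi\<^sub>M \<Gamma> M \<rightarrow>\<^sub>M Pi\<^sub>M (\<Gamma> \<union> (J - \<Gamma>)) M"
      by measurable
    then show ?thesis unfolding un by (simp add: redraw_def[abs_def] case_prod_beta)
  qed
  note [measurable] = r
  have "(\<integral>\<^sup>+u. \<integral>\<^sup>+w. ennreal (h (redraw J \<Gamma> u w)) \<partial>Pi\<^sub>M \<Gamma> M \<partial>Pi\<^sub>M (J - \<Gamma>) M) = 1"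
    using nn_integral_PiM_redraw[OF finite_J sigma_finite_factor \<Gamma>, where f="\<lambda>z. ennreal (h z)"] h_total by simp
  then have "AE u in Pi\<^sub>M (J - \<Gamma>) M. (\<integral>\<^sup>+w. ennreal (h (redraw J \<Gamma> u w)) \<partial>Pi\<^sub>M \<Gamma> M) \<noteq> \<infinity>"
    by (intro nn_integral_PInf_AE) auto
  then show ?thesis
    using AE_space
  proof eventually_elim
    case (elim u)
    have meas[measurable]: "(\<lambda>w. h (redraw J \<Gamma> u w)) \<in> borel_measurable (Pi\<^sub>M \<Gamma> M)"
      using measurable_compose[OF measurable_compose[OF measurable_Pair1'[OF elim(2)] r] h_measurable] by simp
    have nonneg: "AE w in Pi\<^sub>M \<Gamma> M. 0 \<le> h (redraw J \<Gamma> u w)"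
      using measurable_space[OF measurable_compose[OF measurable_Pair1'[OF elim(2)] r]] 
      by (auto intro!: AE_I2 h_nonneg)
    have int: "integrable (Pi\<^sub>M \<Gamma> M) (\<lambda>w. h (redraw J \<Gamma> u w))"
      using elim(1) nonneg by (intro integrableI_nonneg) (auto simp: less_top)
    have "0 \<le> block_mass M J \<Gamma> h u"
      unfolding block_mass_def using nonneg by (rule integral_nonneg_AE)
    moreover have "AE w in Pi\<^sub>M \<Gamma> M. h (redraw J \<Gamma> u w) = 0" if "block_mass M J \<Gamma> h u = 0"
      using that integral_nonneg_eq_0_iff_AE[OF int nonneg] unfolding block_mass_def by simp
    ultimately show ?case by force
  qed
qed

lemma AE_block_mass_pos:
  assumes \<Gamma>: "\<Gamma> \<subseteq> J"
  shows "AE z in \<nu>. 0 < block_mass M J \<Gamma> h z"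
proof -
  note [measurable] = measurable_block_mass[OF \<Gamma>]
  define g where "g z = ennreal (h z) * indicator {z \<in> space (Pi\<^sub>M J M). \<not> 0 < block_mass M J \<Gamma> h z} z" for z
  have g[measurable]: "g \<in> borel_measurable (Pi\<^sub>M J M)"
    unfolding g_def by measurable
  have "(\<integral>\<^sup>+z. g z \<partial>Pi\<^sub>M J M)
      = (\<integral>\<^sup>+u. \<integral>\<^sup>+w. g (redraw J \<Gamma> u w) \<partial>Pi\<^sub>M \<Gamma> M \<partial>Pi\<^sub>M (J - \<Gamma>) M)"
    by (rule nn_integral_PiM_redraw[OF finite_J sigma_finite_factor \<Gamma> g])
  also have "\<dots> = (\<integral>\<^sup>+u. 0 \<partial>Pi\<^sub>M (J - \<Gamma>) M)"
  proof (rule nn_integral_cong_AE)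
    show "AE u in Pi\<^sub>M (J - \<Gamma>) M. (\<integral>\<^sup>+w. g (redraw J \<Gamma> u w) \<partial>Pi\<^sub>M \<Gamma> M) = 0"
      using AE_block_mass_zero[OF \<Gamma>]
    proof eventually_elim
      case (elim u)
      then have "AE w in Pi\<^sub>M \<Gamma> M. g (redraw J \<Gamma> u w) = 0"
      proof
        assume "0 < block_mass M J \<Gamma> h u"
        then show ?thesis by (simp add: g_def block_mass_redraw)
      next
        assume "AE w in Pi\<^sub>M \<Gamma> M. h (redraw J \<Gamma> u w) = 0"
        then show ?thesis by eventually_elim (simp add: g_def)
      qed
      then have "(\<integral>\<^sup>+w. g (redraw J \<Gamma> u w) \<partial>Pi\<^sub>M \<Gamma> M) = (\<integral>\<^sup>+w. 0 \<partial>Pi\<^sub>M \<Gamma> M)"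
        by (rule nn_integral_cong_AE)
      then show ?case by simp
    qed
  qed
  finally have "AE z in Pi\<^sub>M J M. g z = 0"
    by (simp add: nn_integral_0_iff_AE)
  then have "AE z in Pi\<^sub>M J M. 0 < ennreal (h z) \<longrightarrow> 0 < block_mass M J \<Gamma> h z"
    using AE_space by eventually_elim (auto simp: g_def indicator_def split: if_splits)
  then show ?thesis by (simp add: AE_density)
qed

text \<open>Invariance along a single fibre, on which only the block \<open>\<Gamma>\<close> varies: the resampled
  integral is constant on the fibre and the normalising constants cancel.\<close>

lemma nn_integral_resample_block:
  assumes \<Gamma>: "\<Gamma> \<subseteq> J" and z: "z \<in> space (Pi\<^sub>M J M)" and pos: "0 < block_mass M J \<Gamma> h z"
    and g[measurable]: "g \<in> borel_measurable (Pi\<^sub>M J M)"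
  shows "(\<integral>\<^sup>+w. ennreal (h (redraw J \<Gamma> z w)) * (\<integral>\<^sup>+x. g x \<partial>resample M J \<Gamma> h (redraw J \<Gamma> z w)) \<partial>Pi\<^sub>M \<Gamma> M)
    = (\<integral>\<^sup>+w. ennreal (h (redraw J \<Gamma> z w)) * g (redraw J \<Gamma> z w) \<partial>Pi\<^sub>M \<Gamma> M)"
proof -
  note [measurable] = measurable_redraw[OF \<Gamma> z]
  let ?p = "block_mass M J \<Gamma> h z"
  let ?I = "\<integral>\<^sup>+w. ennreal (h (redraw J \<Gamma> z w)) * g (redraw J \<Gamma> z w) \<partial>Pi\<^sub>M \<Gamma> M"
  have "(\<integral>\<^sup>+x. g x \<partial>resample M J \<Gamma> h z)
      = (\<integral>\<^sup>+w. ennreal (block_density M J \<Gamma> h z w) * g (redraw J \<Gamma> z w) \<partial>Pi\<^sub>M \<Gamma> M)"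
    using nn_integral_resample[OF \<Gamma> z g] pos by simp
  also have "\<dots> = (\<integral>\<^sup>+w. ennreal (h (redraw J \<Gamma> z w)) * g (redraw J \<Gamma> z w) / ennreal ?p \<partial>Pi\<^sub>M \<Gamma> M)"
    using pos \<Gamma> z
    by (intro nn_integral_cong)
       (simp add: block_density_def divide_ennreal[symmetric] h_nonneg redraw_space ennreal_times_divide mult.commute)
  also have "\<dots> = ?I / ennreal ?p"
    by (rule nn_integral_divide) measurable
  finally have G: "(\<integral>\<^sup>+x. g x \<partial>resample M J \<Gamma> h z) = ?I / ennreal ?p" .
  have "(\<integral>\<^sup>+w. ennreal (h (redraw J \<Gamma> z w)) * (\<integral>\<^sup>+x. g x \<partial>resample M J \<Gamma> h (redraw J \<Gamma> z w)) \<partial>Pi\<^sub>M \<Gamma> M)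
      = (\<integral>\<^sup>+w. ennreal (h (redraw J \<Gamma> z w)) \<partial>Pi\<^sub>M \<Gamma> M) * (?I / ennreal ?p)"
    by (simp add: resample_redraw[OF pos] G nn_integral_multc)
  also have "\<dots> = ennreal ?p * (?I / ennreal ?p)"
    by (simp add: nn_integral_block[OF \<Gamma> z pos])
  also have "\<dots> = ?I * ennreal ?p / ennreal ?p"
    by (simp only: ennreal_times_divide mult.commute)
  also have "\<dots> = ?I"
    using pos by (intro mult_divide_eq_ennreal) auto
  finally show ?thesis .
qed

lemma nn_integral_resample_stationary:
  assumes \<Gamma>: "\<Gamma> \<subseteq> J" and g[measurable]: "g \<in> borel_measurable (Pi\<^sub>M J M)"
  shows "(\<integral>\<^sup>+z. \<integral>\<^sup>+x. g x \<partial>resample M J \<Gamma> h z \<partial>\<nu>) = (\<integral>\<^sup>+z. g z \<partial>\<nu>)"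
proof -
  define G where "G z = (\<integral>\<^sup>+x. g x \<partial>resample M J \<Gamma> h z)" for z
  have G[measurable]: "G \<in> borel_measurable (Pi\<^sub>M J M)"
    unfolding G_def
    by (rule measurable_compose[OF measurable_prob_algebraD[OF measurable_resample[OF \<Gamma>]]
          nn_integral_measurable_subprob_algebra[OF g]])
  have fold: "(\<integral>\<^sup>+z. ennreal (h z) * f z \<partial>Pi\<^sub>M J M) = (\<integral>\<^sup>+u. \<integral>\<^sup>+w. ennreal (h (redraw J \<Gamma> u w)) * f (redraw J \<Gamma> u w) \<partial>Pi\<^sub>M \<Gamma> M \<partial>Pi\<^sub>M (J - \<Gamma>) M)"
    if [measurable]: "f \<in> borel_measurable (Pi\<^sub>M J M)" for f
    by (rule nn_integral_PiM_redraw[OF finite_J sigma_finite_factor \<Gamma>]) measurable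
  have un: "\<Gamma> \<union> (J - \<Gamma>) = J" using \<Gamma> by auto
  have "(\<integral>\<^sup>+z. G z \<partial>\<nu>) = (\<integral>\<^sup>+u. \<integral>\<^sup>+w. ennreal (h (redraw J \<Gamma> u w)) * G (redraw J \<Gamma> u w) \<partial>Pi\<^sub>M \<Gamma> M \<partial>Pi\<^sub>M (J - \<Gamma>) M)"
    by (simp add: nn_integral_density fold)
  also have "\<dots> = (\<integral>\<^sup>+u. \<integral>\<^sup>+w. ennreal (h (redraw J \<Gamma> u w)) * g (redraw J \<Gamma> u w) \<partial>Pi\<^sub>M \<Gamma> M \<partial>Pi\<^sub>M (J - \<Gamma>) M)"
  proof (rule nn_integral_cong_AE)
    show "AE u in Pi\<^sub>M (J - \<Gamma>) M.
        (\<integral>\<^sup>+w. ennreal (h (redraw J \<Gamma> u w)) * G (redraw J \<Gamma> u w) \<partial>Pi\<^sub>M \<Gamma> M)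
      = (\<integral>\<^sup>+w. ennreal (h (redraw J \<Gamma> u w)) * g (redraw J \<Gamma> u w) \<partial>Pi\<^sub>M \<Gamma> M)"
      using AE_block_mass_zero[OF \<Gamma>] AE_space
    proof eventually_elim
      case (elim u)
      from elim(1) show ?case
      proof
        assume pos: "0 < block_mass M J \<Gamma> h u"
        show ?thesis
        proof (cases "space (Pi\<^sub>M \<Gamma> M) = {}")
          case True
          then show ?thesis by (simp add: nn_integral_empty)
        next
          case False
          \<comment> \<open>\<open>u\<close> carries only the coordinates outside the block; any completion serves as base point.\<close>
          then obtain w0 where w0: "w0 \<in> space (Pi\<^sub>M \<Gamma> M)" by blast
          have "merge \<Gamma> (J - \<Gamma>) (w0, u) \<in> space (Pi\<^sub>M (\<Gamma> \<union> (J - \<Gamma>)) M)"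
            using w0 elim(2) by (intro measurable_space[OF measurable_merge]) (auto simp: space_pair_measure)
          then have z: "redraw J \<Gamma> u w0 \<in> space (Pi\<^sub>M J M)"
            unfolding un by (simp add: redraw_def)
          show ?thesis
            using nn_integral_resample_block[OF \<Gamma> z _ g] pos
            by (simp add: block_mass_redraw redraw_redraw G_def)
        qed
      next
        assume 0: "AE w in Pi\<^sub>M \<Gamma> M. h (redraw J \<Gamma> u w) = 0"
        have "(\<integral>\<^sup>+w. ennreal (h (redraw J \<Gamma> u w)) * f (redraw J \<Gamma> u w) \<partial>Pi\<^sub>M \<Gamma> M) = (\<integral>\<^sup>+w. 0 \<partial>Pi\<^sub>M \<Gamma> M)" for f
        proof (rule nn_integral_cong_AE)
          show "AE w in Pi\<^sub>M \<Gamma> M. ennreal (h (redraw J \<Gamma> u w)) * f (redraw J \<Gamma> u w) = 0"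
            using 0 by eventually_elim simp
        qed
        then show ?thesis by simp
      qed
    qed
  qed
  also have "\<dots> = (\<integral>\<^sup>+z. g z \<partial>\<nu>)"
    by (simp add: nn_integral_density fold)
  finally show ?thesis by (simp add: G_def)
qed

lemma kernel_op_resample:
  fixes f :: "('i \<Rightarrow> 'a) \<Rightarrow> real"
  assumes \<Gamma>: "\<Gamma> \<subseteq> J" and z: "z \<in> space (Pi\<^sub>M J M)" and pos: "0 < block_mass M J \<Gamma> h z"
    and f: "f \<in> borel_measurable (Pi\<^sub>M J M)"
  shows "kernel_op (resample M J \<Gamma> h) f z
    = (\<integral>w. f (redraw J \<Gamma> z w) \<partial>density (Pi\<^sub>M \<Gamma> M) (\<lambda>w. ennreal (block_density M J \<Gamma> h z w)))"
  using pos measurable_redraw[OF \<Gamma> z] f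
  by (simp add: kernel_op_def resample_def integral_distr)

lemma projection_kernel_resample:
  assumes \<Gamma>: "\<Gamma> \<subseteq> J"
  shows "projection_kernel \<nu> (resample M J \<Gamma> h)"
proof -
  let ?R = "resample M J \<Gamma> h"
  interpret prob_space \<nu> by (rule prob_space_\<nu>)
  have pa: "prob_algebra \<nu> = prob_algebra (Pi\<^sub>M J M)"
    using subprob_algebra_cong[of \<nu> "Pi\<^sub>M J M"] by (simp add: prob_algebra_def)
  have R: "?R \<in> \<nu> \<rightarrow>\<^sub>M prob_algebra \<nu>"
    unfolding pa using measurable_resample[OF \<Gamma>] by simp
  note Rs = measurable_prob_algebraD[OF R]
  show ?thesis
  proof
    show "?R \<in> \<nu> \<rightarrow>\<^sub>M prob_algebra \<nu>" by (rule R)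
    show "\<nu> \<bind> ?R = \<nu>"
    proof (rule measure_eqI)
      show s: "sets (\<nu> \<bind> ?R) = sets \<nu>"
        using sets_bind_measurable[OF Rs not_empty] .
      fix A assume "A \<in> sets (\<nu> \<bind> ?R)"
      then have A: "A \<in> sets (Pi\<^sub>M J M)" "A \<in> sets (\<nu> \<bind> ?R)" "A \<in> sets \<nu>" unfolding s by auto
      have "emeasure (\<nu> \<bind> ?R) A = (\<integral>\<^sup>+x. indicator A x \<partial>(\<nu> \<bind> ?R))"
        using A by simp
      also have "\<dots> = (\<integral>\<^sup>+z. \<integral>\<^sup>+x. indicator A x \<partial>?R z \<partial>\<nu>)"
        using A by (intro nn_integral_bind[OF _ Rs]) auto
      also have "\<dots> = (\<integral>\<^sup>+z. indicator A z \<partial>\<nu>)"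
        using A by (intro nn_integral_resample_stationary[OF \<Gamma>]) auto
      also have "\<dots> = emeasure \<nu> A" using A by simp
      finally show "emeasure (\<nu> \<bind> ?R) A = emeasure \<nu> A" .
    qed
    fix f :: "('i \<Rightarrow> 'a) \<Rightarrow> real" assume "f \<in> borel_measurable \<nu>"
    then have [measurable]: "f \<in> borel_measurable (Pi\<^sub>M J M)" by simp
    have [measurable]: "kernel_op ?R f \<in> borel_measurable (Pi\<^sub>M J M)"
      unfolding kernel_op_def
      by (rule measurable_compose[OF measurable_prob_algebraD[OF measurable_resample[OF \<Gamma>]]
            integral_measurable_subprob_algebra]) simp
    show "AE x in \<nu>. AE x' in ?R x. kernel_op ?R f x' = kernel_op ?R f x"
      using AE_block_mass_pos[OF \<Gamma>] AE_space
    proof eventually_elim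
      case (elim x)
      then have x: "x \<in> space (Pi\<^sub>M J M)" by simp
      note [measurable] = measurable_redraw[OF \<Gamma> x]
      have const: "kernel_op ?R f (redraw J \<Gamma> x w) = kernel_op ?R f x" for w
        using resample_redraw[OF elim(1)] by (simp add: kernel_op_def)
      have eq: "?R x = distr (density (Pi\<^sub>M \<Gamma> M) (\<lambda>w. ennreal (block_density M J \<Gamma> h x w))) (Pi\<^sub>M J M) (redraw J \<Gamma> x)"
        using elim(1) by (simp add: resample_def)
      show ?case
        unfolding eq by (subst AE_distr_iff) (auto simp: const)
    qed
  qed
qed

end

lemma block_mass_nested:
  assumes "\<Gamma> \<subseteq> \<Delta>" "\<Delta> \<subseteq> J"
  shows "block_mass M \<Delta> \<Gamma> (block_density M J \<Delta> h z) w
    = block_mass M J \<Gamma> h (redraw J \<Delta> z w) / block_mass M J \<Delta> h z"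
  unfolding block_mass_def[of M \<Delta> \<Gamma>] block_mass_def[of M J \<Gamma>] block_density_def
  by (simp add: redraw_nested[OF assms])

lemma block_density_nested:
  assumes "\<Gamma> \<subseteq> \<Delta>" "\<Delta> \<subseteq> J" "0 < block_mass M J \<Delta> h z"
  shows "block_density M \<Delta> \<Gamma> (block_density M J \<Delta> h z) w u = block_density M J \<Gamma> h (redraw J \<Delta> z w) u"
  unfolding block_density_def[of M \<Delta> \<Gamma>] block_mass_nested[OF assms(1,2)]
  using assms(3) by (simp add: block_density_def redraw_nested[OF assms(1,2)])

text \<open>
  Fix the coordinates outside \<open>\<Delta>\<close>. On the remaining coordinates, redrawing a block
  \<open>\<Gamma> \<subseteq> \<Delta>\<close> under \<open>h\<close> is the same as redrawing it under the conditional density of \<open>\<Delta>\<close>.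
\<close>

lemma resample_nested:
  assumes sub: "\<Gamma> \<subseteq> \<Delta>" "\<Delta> \<subseteq> J" and pos: "0 < block_mass M J \<Delta> h z"
    and z: "z \<in> space (Pi\<^sub>M J M)" and w: "w \<in> space (Pi\<^sub>M \<Delta> M)"
  shows "resample M J \<Gamma> h (redraw J \<Delta> z w)
    = distr (resample M \<Delta> \<Gamma> (block_density M J \<Delta> h z) w) (Pi\<^sub>M J M) (redraw J \<Delta> z)"
proof (cases "0 < block_mass M J \<Gamma> h (redraw J \<Delta> z w)")
  case True
  then have "0 < block_mass M \<Delta> \<Gamma> (block_density M J \<Delta> h z) w"
    using pos by (simp add: block_mass_nested[OF sub])
  then have "distr (resample M \<Delta> \<Gamma> (block_density M J \<Delta> h z) w) (Pi\<^sub>M J M) (redraw J \<Delta> z)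
    = distr (density (Pi\<^sub>M \<Gamma> M) (\<lambda>u. ennreal (block_density M J \<Gamma> h (redraw J \<Delta> z w) u))) (Pi\<^sub>M J M)
        (redraw J \<Delta> z \<circ> redraw \<Delta> \<Gamma> w)"
    using measurable_redraw[OF sub(2) z] measurable_redraw[OF sub(1) w]
    by (simp add: resample_def distr_distr block_density_nested[OF sub pos])
  also have "redraw J \<Delta> z \<circ> redraw \<Delta> \<Gamma> w = redraw J \<Gamma> (redraw J \<Delta> z w)"
    by (simp add: fun_eq_iff redraw_nested[OF sub])
  finally show ?thesis
    using True by (simp add: resample_def)
next
  case False
  then have "\<not> 0 < block_mass M \<Delta> \<Gamma> (block_density M J \<Delta> h z) w"
    using pos by (simp add: block_mass_nested[OF sub] zero_less_divide_iff)
  then show ?thesis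
    using False distr_return[OF measurable_redraw[OF sub(2) z] w] by (simp add: resample_def)
qed

lemma kernel_op_resample_nested:
  fixes f :: "('i \<Rightarrow> 'a) \<Rightarrow> real"
  assumes sub: "\<Gamma> \<subseteq> \<Delta>" "\<Delta> \<subseteq> J" and pos: "0 < block_mass M J \<Delta> h z"
    and z: "z \<in> space (Pi\<^sub>M J M)" and w: "w \<in> space (Pi\<^sub>M \<Delta> M)"
    and f: "f \<in> borel_measurable (Pi\<^sub>M J M)"
  shows "kernel_op (resample M J \<Gamma> h) f (redraw J \<Delta> z w)
    = kernel_op (resample M \<Delta> \<Gamma> (block_density M J \<Delta> h z)) (\<lambda>w. f (redraw J \<Delta> z w)) w"
proof -
  have "redraw J \<Delta> z \<in> resample M \<Delta> \<Gamma> (block_density M J \<Delta> h z) w \<rightarrow>\<^sub>M Pi\<^sub>M J M"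
    using measurable_redraw[OF sub(2) z] by (simp add: resample_def)
  then show ?thesis
    unfolding kernel_op_def resample_nested[OF sub pos z w] using f by (rule integral_distr)
qed

section \<open>Composition of Poincare inequalities\<close>

text \<open>Every \<open>l\<close>-subset of \<open>J\<close> avoids exactly \<open>card J - l\<close> elements of \<open>J\<close>.\<close>

lemma sum_subsets_delete:
  fixes a :: "'i set \<Rightarrow> real"
  assumes J: "finite J"
  shows "(\<Sum>i\<in>J. \<Sum>\<Gamma> | \<Gamma> \<subseteq> J - {i} \<and> card \<Gamma> = l. a \<Gamma>)
    = (real (card J) - real l) * (\<Sum>\<Gamma> | \<Gamma> \<subseteq> J \<and> card \<Gamma> = l. a \<Gamma>)"
proof -
  let ?S = "{\<Gamma>. \<Gamma> \<subseteq> J \<and> card \<Gamma> = l}"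
  have "(\<Sum>i\<in>J. \<Sum>\<Gamma> | \<Gamma> \<subseteq> J - {i} \<and> card \<Gamma> = l. a \<Gamma>) = (\<Sum>i\<in>J. \<Sum>\<Gamma>\<in>{\<Gamma>\<in>?S. i \<notin> \<Gamma>}. a \<Gamma>)"
    by (intro sum.cong) auto
  also have "\<dots> = (\<Sum>\<Gamma>\<in>?S. \<Sum>i\<in>{i\<in>J. i \<notin> \<Gamma>}. a \<Gamma>)"
    using J by (intro sum.swap_restrict) auto
  also have "\<dots> = (\<Sum>\<Gamma>\<in>?S. (real (card J) - real l) * a \<Gamma>)"
  proof (rule sum.cong)
    fix \<Gamma> assume \<Gamma>: "\<Gamma> \<in> ?S"
    have "{i\<in>J. i \<notin> \<Gamma>} = J - \<Gamma>" by auto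
    moreover have "card (J - \<Gamma>) = card J - l" "l \<le> card J"
      using \<Gamma> J by (auto simp: card_Diff_subset finite_subset intro: card_mono)
    ultimately show "(\<Sum>i\<in>{i\<in>J. i \<notin> \<Gamma>}. a \<Gamma>) = (real (card J) - real l) * a \<Gamma>"
      by (simp add: of_nat_diff)
  qed simp
  finally show ?thesis by (simp add: sum_distrib_left)
qed

lemma sum_subsets_codim_one:
  fixes a :: "'i set \<Rightarrow> real"
  assumes J: "finite J" "J \<noteq> {}"
  shows "(\<Sum>\<Gamma> | \<Gamma> \<subseteq> J \<and> card \<Gamma> = card J - 1. a \<Gamma>) = (\<Sum>i\<in>J. a (J - {i}))"
proof -
  have "{\<Gamma>. \<Gamma> \<subseteq> J \<and> card \<Gamma> = card J - 1} = (\<lambda>i. J - {i}) ` J"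
  proof (intro equalityI subsetI)
    fix \<Gamma> assume "\<Gamma> \<in> {\<Gamma>. \<Gamma> \<subseteq> J \<and> card \<Gamma> = card J - 1}"
    then have \<Gamma>: "\<Gamma> \<subseteq> J" "card \<Gamma> = card J - 1" by auto
    have "card (J - \<Gamma>) = card J - card \<Gamma>" using \<Gamma> J by (intro card_Diff_subset) (auto simp: finite_subset)
    then have "card (J - \<Gamma>) = 1" using \<Gamma> J by (simp add: card_gt_0_iff Suc_leI)
    then obtain i where "J - \<Gamma> = {i}" by (rule card_1_singletonE)
    then have "i \<in> J" "\<Gamma> = J - {i}" using \<Gamma> by auto
    then show "\<Gamma> \<in> (\<lambda>i. J - {i}) ` J" by auto
  qed (use J in auto)
  moreover have "inj_on (\<lambda>i. J - {i}) J" by (auto simp: inj_on_def)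
  ultimately show ?thesis by (simp add: sum.reindex)
qed

lemma card_times_choose_pred:
  assumes "l < m"
  shows "real m * real ((m - 1) choose l) = (real m - real l) * real (m choose l)"
proof -
  have "(m - l) * (m choose l) = m * ((m - 1) choose l)"
    by (rule binomial_absorb_comp)
  then have "real (m - l) * real (m choose l) = real m * real ((m - 1) choose l)"
    by (metis of_nat_mult)
  then show ?thesis using assms by (simp add: of_nat_diff)
qed

context product_density
begin

text \<open>
  If, for every value of the coordinates outside \<open>\<Delta>\<close>, the conditional law of \<open>\<Delta>\<close> satisfies
  a Poincare inequality for blocks inside \<open>\<Delta>\<close>, then so does \<open>\<nu>\<close>, with the variance replaced
  by the expected conditional variance \<open>\<parallel>f\<parallel>\<^sup>2 - \<parallel>P\<^sub>\<Delta> f\<parallel>\<^sup>2\<close>.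
\<close>

lemma dirichlet_form_conditional:
  assumes \<Delta>: "\<Delta> \<subseteq> J" and B: "finite B" "\<And>\<Gamma>. \<Gamma> \<in> B \<Longrightarrow> \<Gamma> \<subseteq> \<Delta>"
    and gap: "\<And>z. z \<in> space (Pi\<^sub>M J M) \<Longrightarrow> 0 < block_mass M J \<Delta> h z \<Longrightarrow>
        poincare (density (Pi\<^sub>M \<Delta> M) (\<lambda>w. ennreal (block_density M J \<Delta> h z w))) B
          (\<lambda>\<Gamma>. resample M \<Delta> \<Gamma> (block_density M J \<Delta> h z)) g"
    and f: "f \<in> L2 \<nu>"
  shows "g * ((\<integral>z. (f z)\<^sup>2 \<partial>\<nu>) - (\<integral>z. (kernel_op (resample M J \<Delta> h) f z)\<^sup>2 \<partial>\<nu>))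
    \<le> dirichlet_form \<nu> B (\<lambda>\<Gamma>. resample M J \<Gamma> h) f"
proof -
  let ?R = "\<lambda>\<Gamma>. resample M J \<Gamma> h"
  let ?N = "real (card B)"
  interpret D: projection_kernel \<nu> "?R \<Delta>" using \<Delta> by (rule projection_kernel_resample)
  have BJ: "\<Gamma> \<subseteq> J" if "\<Gamma> \<in> B" for \<Gamma> using B(2)[OF that] \<Delta> by auto
  have L2: "kernel_op (?R \<Gamma>) f \<in> L2 \<nu>" if "\<Gamma> \<in> B" for \<Gamma>
    using projection_kernel_resample[OF BJ[OF that]] f by (rule projection_kernel.kernel_op_L2)
  have fm[measurable]: "f \<in> borel_measurable (Pi\<^sub>M J M)" using L2_measurable[OF f] by simp
  \<comment> \<open>The integrand of the Dirichlet form: its mean under \<open>\<nu>\<close> is the form itself, and its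
    conditional mean given the coordinates outside \<open>\<Delta>\<close> is the conditional Dirichlet form.\<close>
  define \<Phi> where "\<Phi> z = (\<Sum>\<Gamma>\<in>B. (f z)\<^sup>2 - (kernel_op (?R \<Gamma>) f z)\<^sup>2) / ?N" for z
  have \<Phi>: "integrable \<nu> \<Phi>"
    unfolding \<Phi>_def using L2_square[OF f] L2_square[OF L2] by auto
  have \<Phi>m: "\<Phi> \<in> borel_measurable (Pi\<^sub>M J M)"
    using \<Phi> by (auto dest: borel_measurable_integrable)
  have dir: "dirichlet_form \<nu> B ?R f = (\<integral>z. \<Phi> z \<partial>\<nu>)"
    unfolding \<Phi>_def dirichlet_form_def using L2_square[OF f] L2_square[OF L2]
    by (simp add: Bochner_Integration.integral_sum)
  have f2: "(\<lambda>z. (f z)\<^sup>2) \<in> borel_measurable (Pi\<^sub>M J M)" by measurable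
  have "AE z in \<nu>. g * (kernel_op (?R \<Delta>) (\<lambda>z. (f z)\<^sup>2) z - (kernel_op (?R \<Delta>) f z)\<^sup>2) \<le> kernel_op (?R \<Delta>) \<Phi> z"
    using AE_block_mass_pos[OF \<Delta>] D.AE_L2_kernel[OF f] AE_space
  proof eventually_elim
    case (elim z)
    note pos = elim(1)
    have z: "z \<in> space (Pi\<^sub>M J M)" using elim(3) by simp
    let ?h = "block_density M J \<Delta> h z"
    interpret z: product_density M \<Delta> ?h using \<Delta> z pos by (rule product_density_block)
    note [measurable] = measurable_redraw[OF \<Delta> z]
    define fz where "fz w = f (redraw J \<Delta> z w)" for w
    have fz: "fz \<in> L2 z.\<nu>"
    proof -
      have "integrable (?R \<Delta> z) (\<lambda>z. (f z)\<^sup>2)" using elim(2) by (rule L2_square)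
      then have "integrable z.\<nu> (\<lambda>w. (fz w)\<^sup>2)"
        using pos unfolding fz_def by (simp add: resample_def integrable_distr_eq)
      then show ?thesis unfolding L2_def fz_def by simp
    qed
    have L2z: "kernel_op (resample M \<Delta> \<Gamma> ?h) fz \<in> L2 z.\<nu>" if "\<Gamma> \<in> B" for \<Gamma>
      using z.projection_kernel_resample[OF B(2)[OF that]] fz by (rule projection_kernel.kernel_op_L2)
    have "kernel_op (?R \<Delta>) \<Phi> z = (\<integral>w. \<Phi> (redraw J \<Delta> z w) \<partial>z.\<nu>)"
      by (rule kernel_op_resample[OF \<Delta> z pos \<Phi>m])
    also have "\<dots> = (\<integral>w. (\<Sum>\<Gamma>\<in>B. (fz w)\<^sup>2 - (kernel_op (resample M \<Delta> \<Gamma> ?h) fz w)\<^sup>2) / ?N \<partial>z.\<nu>)"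
    proof (rule Bochner_Integration.integral_cong)
      fix w assume "w \<in> space z.\<nu>"
      then have w: "w \<in> space (Pi\<^sub>M \<Delta> M)" by simp
      have "kernel_op (?R \<Gamma>) f (redraw J \<Delta> z w) = kernel_op (resample M \<Delta> \<Gamma> ?h) fz w" if "\<Gamma> \<in> B" for \<Gamma>
        unfolding fz_def by (rule kernel_op_resample_nested[OF B(2)[OF that] \<Delta> pos z w fm])
      then show "\<Phi> (redraw J \<Delta> z w) = (\<Sum>\<Gamma>\<in>B. (fz w)\<^sup>2 - (kernel_op (resample M \<Delta> \<Gamma> ?h) fz w)\<^sup>2) / ?N"
        by (simp add: \<Phi>_def fz_def)
    qed simp
    also have "\<dots> = dirichlet_form z.\<nu> B (\<lambda>\<Gamma>. resample M \<Delta> \<Gamma> ?h) fz"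
      unfolding dirichlet_form_def using L2_square[OF fz] L2_square[OF L2z]
      by (simp add: Bochner_Integration.integral_sum)
    finally have "kernel_op (?R \<Delta>) \<Phi> z = dirichlet_form z.\<nu> B (\<lambda>\<Gamma>. resample M \<Delta> \<Gamma> ?h) fz" .
    moreover have "kernel_op (?R \<Delta>) f z = (\<integral>w. fz w \<partial>z.\<nu>)"
      unfolding fz_def by (rule kernel_op_resample[OF \<Delta> z pos fm])
    moreover have "kernel_op (?R \<Delta>) (\<lambda>z. (f z)\<^sup>2) z = (\<integral>w. (fz w)\<^sup>2 \<partial>z.\<nu>)"
      unfolding fz_def by (rule kernel_op_resample[OF \<Delta> z pos f2])
    ultimately show ?case
      using gap[OF z pos] fz unfolding poincare_def by auto
  qed
  moreover have i: "integrable \<nu> (kernel_op (?R \<Delta>) (\<lambda>z. (f z)\<^sup>2))"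
      "integrable \<nu> (\<lambda>z. (kernel_op (?R \<Delta>) f z)\<^sup>2)"
    using D.integrable_kernel_op[OF L2_square[OF f]] L2_square[OF D.kernel_op_L2[OF f]] by auto
  ultimately have "(\<integral>z. g * (kernel_op (?R \<Delta>) (\<lambda>z. (f z)\<^sup>2) z - (kernel_op (?R \<Delta>) f z)\<^sup>2) \<partial>\<nu>)
      \<le> (\<integral>z. kernel_op (?R \<Delta>) \<Phi> z \<partial>\<nu>)"
    by (intro integral_mono_AE D.integrable_kernel_op[OF \<Phi>]) auto
  also have "\<dots> = dirichlet_form \<nu> B ?R f"
    using D.integral_kernel_op[OF \<Phi>] dir by simp
  finally show ?thesis
    using i D.integral_kernel_op[OF L2_square[OF f]] by simp
qed

text \<open>
  The average over \<open>i \<in> J\<close> and over the \<open>l\<close>-subsets of \<open>J - {i}\<close> is the average over the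
  \<open>l\<close>-subsets of \<open>J\<close>, by \<open>sum_subsets_delete\<close> and \<open>card_times_choose_pred\<close>.
\<close>

theorem poincare_compose:
  assumes J: "J \<noteq> {}" and l: "l < card J"
    and outer: "poincare \<nu> {\<Gamma>. \<Gamma> \<subseteq> J \<and> card \<Gamma> = card J - 1} (\<lambda>\<Gamma>. resample M J \<Gamma> h) g1"
    and inner: "\<And>i z. i \<in> J \<Longrightarrow> z \<in> space (Pi\<^sub>M J M) \<Longrightarrow> 0 < block_mass M J (J - {i}) h z \<Longrightarrow>
        poincare (density (Pi\<^sub>M (J - {i}) M) (\<lambda>w. ennreal (block_density M J (J - {i}) h z w)))
          {\<Gamma>. \<Gamma> \<subseteq> J - {i} \<and> card \<Gamma> = l}
          (\<lambda>\<Gamma>. resample M (J - {i}) \<Gamma> (block_density M J (J - {i}) h z)) g2"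
    and g2: "0 \<le> g2"
  shows "poincare \<nu> {\<Gamma>. \<Gamma> \<subseteq> J \<and> card \<Gamma> = l} (\<lambda>\<Gamma>. resample M J \<Gamma> h) (g1 * g2)"
  unfolding poincare_def
proof
  fix f assume f: "f \<in> L2 \<nu>"
  define a where "a \<Gamma> = (\<integral>z. (f z)\<^sup>2 \<partial>\<nu>) - (\<integral>z. (kernel_op (resample M J \<Gamma> h) f z)\<^sup>2 \<partial>\<nu>)" for \<Gamma>
  let ?V = "(\<integral>z. (f z)\<^sup>2 \<partial>\<nu>) - (\<integral>z. f z \<partial>\<nu>)\<^sup>2"
  define m where "m = card J"
  have m: "0 < m" "l < m" using J finite_J l by (auto simp: m_def card_gt_0_iff)
  let ?S = "\<Sum>\<Gamma> | \<Gamma> \<subseteq> J \<and> card \<Gamma> = l. a \<Gamma>"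
  have "m choose (m - 1) = m"
    using m binomial_symmetric[of 1 m] by simp
  then have D1: "dirichlet_form \<nu> {\<Gamma>. \<Gamma> \<subseteq> J \<and> card \<Gamma> = card J - 1} (\<lambda>\<Gamma>. resample M J \<Gamma> h) f
      = (\<Sum>i\<in>J. a (J - {i})) / real m"
    using J finite_J unfolding dirichlet_form_def a_def[symmetric]
    by (simp add: sum_subsets_codim_one[of J a, OF finite_J J, folded One_nat_def, simplified] n_subsets m_def)
  have c: "0 < real (m choose l)" "0 < real ((m - 1) choose l)"
    using m by (auto simp: zero_less_binomial)
  have D2: "g2 * a (J - {i}) \<le> (\<Sum>\<Gamma> | \<Gamma> \<subseteq> J - {i} \<and> card \<Gamma> = l. a \<Gamma>) / real ((m - 1) choose l)" if i: "i \<in> J" for i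
  proof -
    have "g2 * a (J - {i}) \<le> dirichlet_form \<nu> {\<Gamma>. \<Gamma> \<subseteq> J - {i} \<and> card \<Gamma> = l} (\<lambda>\<Gamma>. resample M J \<Gamma> h) f"
      unfolding a_def
      by (rule dirichlet_form_conditional) (use i inner f finite_J in auto)
    then show ?thesis
      using i finite_J by (simp add: dirichlet_form_def a_def[symmetric] n_subsets m_def)
  qed
  have "g1 * g2 * ?V = g2 * (g1 * ?V)" by simp
  also have "\<dots> \<le> g2 * ((\<Sum>i\<in>J. a (J - {i})) / real m)"
    using outer f g2 D1 unfolding poincare_def by (intro mult_left_mono) auto
  also have "\<dots> = (\<Sum>i\<in>J. g2 * a (J - {i})) / real m"
    by (simp add: sum_distrib_left)
  also have "\<dots> \<le> (\<Sum>i\<in>J. (\<Sum>\<Gamma> | \<Gamma> \<subseteq> J - {i} \<and> card \<Gamma> = l. a \<Gamma>) / real ((m - 1) choose l)) / real m"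
    using D2 by (intro divide_right_mono sum_mono) auto
  also have "\<dots> = ((real m - real l) * ?S) / (real m * real ((m - 1) choose l))"
    using sum_subsets_delete[OF finite_J, of a l]
    by (simp add: m_def sum_divide_distrib[symmetric] mult.commute)
  also have "\<dots> = ?S / real (m choose l)"
    using m unfolding card_times_choose_pred[OF m(2)] by simp
  also have "\<dots> = dirichlet_form \<nu> {\<Gamma>. \<Gamma> \<subseteq> J \<and> card \<Gamma> = l} (\<lambda>\<Gamma>. resample M J \<Gamma> h) f"
    using finite_J by (simp add: dirichlet_form_def a_def[symmetric] n_subsets m_def)
  finally show "g1 * g2 * ?V \<le> dirichlet_form \<nu> {\<Gamma>. \<Gamma> \<subseteq> J \<and> card \<Gamma> = l} (\<lambda>\<Gamma>. resample M J \<Gamma> h) f" .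
qed

end

section \<open>Integrals with respect to uniform mixtures\<close>

lemma nn_integral_uniform_bind:
  assumes S: "finite S" "S \<noteq> {}"
    and N: "\<And>a. a \<in> S \<Longrightarrow> N a \<in> space (subprob_algebra B)"
    and f: "f \<in> borel_measurable B"
  shows "(\<integral>\<^sup>+x. f x \<partial>(uniform_count_measure S \<bind> N))
    = (\<Sum>a\<in>S. ennreal (1 / real (card S)) * (\<integral>\<^sup>+x. f x \<partial>N a))"
proof -
  have "N \<in> uniform_count_measure S \<rightarrow>\<^sub>M subprob_algebra B"
    using N by (auto simp: measurable_def space_uniform_count_measure sets_uniform_count_measure)
  from nn_integral_bind[OF f this] show ?thesis
    using S by (simp add: uniform_count_measure_def nn_integral_point_measure_finite)
qed

lemma integral_uniform_bind:
  fixes f :: "'b \<Rightarrow> real"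
  assumes S: "finite S" "S \<noteq> {}"
    and N: "\<And>a. a \<in> S \<Longrightarrow> N a \<in> space (subprob_algebra B)"
    and f: "\<And>a. a \<in> S \<Longrightarrow> integrable (N a) f"
  shows "(\<integral>x. f x \<partial>(uniform_count_measure S \<bind> N)) = (\<Sum>a\<in>S. \<integral>x. f x \<partial>N a) / real (card S)"
proof -
  let ?c = "1 / real (card S)"
  have setsN: "sets (N a) = sets B" if "a \<in> S" for a
    using N[OF that] by (simp add: space_subprob_algebra)
  obtain a0 where a0: "a0 \<in> S" using S by auto
  have fB[measurable]: "f \<in> borel_measurable B"
    using borel_measurable_integrable[OF f[OF a0]] measurable_cong_sets[OF setsN[OF a0] refl] by blast
  have fin: "(\<integral>\<^sup>+x. ennreal (f x) \<partial>N a) \<noteq> \<infinity>" "(\<integral>\<^sup>+x. ennreal (- f x) \<partial>N a) \<noteq> \<infinity>"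
    "(\<integral>\<^sup>+x. ennreal (norm (f x)) \<partial>N a) \<noteq> \<infinity>" if "a \<in> S" for a
    using f[OF that] real_integrable_def[of "N a" f] by (auto simp: integrable_iff_bounded)
  have eq: "enn2real (\<integral>\<^sup>+x. ennreal (g x) \<partial>(uniform_count_measure S \<bind> N))
      = (\<Sum>a\<in>S. enn2real (\<integral>\<^sup>+x. ennreal (g x) \<partial>N a)) / real (card S)"
    if "g \<in> borel_measurable B" "\<And>a. a \<in> S \<Longrightarrow> (\<integral>\<^sup>+x. ennreal (g x) \<partial>N a) \<noteq> \<infinity>" for g :: "'b \<Rightarrow> real"
  proof -
    have "(\<integral>\<^sup>+x. ennreal (g x) \<partial>(uniform_count_measure S \<bind> N))
        = (\<Sum>a\<in>S. ennreal ?c * (\<integral>\<^sup>+x. ennreal (g x) \<partial>N a))"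
      using that(1) by (intro nn_integral_uniform_bind[OF S N]) auto
    also have "\<dots> = (\<Sum>a\<in>S. ennreal (?c * enn2real (\<integral>\<^sup>+x. ennreal (g x) \<partial>N a)))"
    proof (rule sum.cong)
      fix a assume "a \<in> S"
      from that(2)[OF this] obtain r where "(\<integral>\<^sup>+x. ennreal (g x) \<partial>N a) = ennreal r" "0 \<le> r"
        by (cases "\<integral>\<^sup>+x. ennreal (g x) \<partial>N a") auto
      then show "ennreal ?c * (\<integral>\<^sup>+x. ennreal (g x) \<partial>N a) = ennreal (?c * enn2real (\<integral>\<^sup>+x. ennreal (g x) \<partial>N a))"
        by (simp only: enn2real_ennreal) (simp add: ennreal_mult[symmetric])
    qed simp
    also have "\<dots> = ennreal (\<Sum>a\<in>S. ?c * enn2real (\<integral>\<^sup>+x. ennreal (g x) \<partial>N a))"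
      by (rule sum_ennreal) auto
    finally show ?thesis
      by (simp add: sum_nonneg sum_divide_distrib)
  qed
  have sb: "sets (uniform_count_measure S \<bind> N) = sets B"
    using S setsN by (intro sets_bind) (auto simp: space_uniform_count_measure)
  have "integrable (uniform_count_measure S \<bind> N) f"
    unfolding integrable_iff_bounded
  proof
    show "f \<in> borel_measurable (uniform_count_measure S \<bind> N)"
      using fB measurable_cong_sets[OF sb refl] by blast
    have "(\<integral>\<^sup>+x. ennreal (norm (f x)) \<partial>(uniform_count_measure S \<bind> N))
        = (\<Sum>a\<in>S. ennreal ?c * (\<integral>\<^sup>+x. ennreal (norm (f x)) \<partial>N a))"
      by (intro nn_integral_uniform_bind[OF S N]) auto
    also have "\<dots> < \<infinity>"
      using S fin(3) by (auto simp: ennreal_mult_less_top less_top)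
    finally show "(\<integral>\<^sup>+x. ennreal (norm (f x)) \<partial>(uniform_count_measure S \<bind> N)) < \<infinity>" .
  qed
  then have "(\<integral>x. f x \<partial>(uniform_count_measure S \<bind> N))
    = (\<Sum>a\<in>S. enn2real (\<integral>\<^sup>+x. ennreal (f x) \<partial>N a) - enn2real (\<integral>\<^sup>+x. ennreal (- f x) \<partial>N a)) / real (card S)"
    using eq[of f] eq[of "\<lambda>x. - f x"] fin
    by (simp add: real_lebesgue_integral_def sum_subtractf diff_divide_distrib)
  then show ?thesis
    using f by (simp add: real_lebesgue_integral_def)
qed

section \<open>Gibbs samplers\<close>

text \<open>
  The joint density \<open>\<pi>\<close> together with the arbitrary densities \<open>alt\<close>. At the conditions \<open>y\<close>
  of positive marginal density, \<open>alt\<close> affects the Gibbs kernels only on null sets.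
\<close>

locale gibbs_setting = joint: product_density M "{1..n}" \<pi>
  for n :: nat and M :: "nat \<Rightarrow> 'a measure" and \<pi> :: "(nat \<Rightarrow> 'a) \<Rightarrow> real" +
  fixes alt :: "nat set \<Rightarrow> nat set \<Rightarrow> (nat \<Rightarrow> 'a) \<Rightarrow> (nat \<Rightarrow> 'a) \<Rightarrow> real"
begin

\<comment> \<open>Otherwise simplification turns the index set \<open>{1..n}\<close> into \<open>{Suc 0..n}\<close>, and facts about
  the former no longer match.\<close>
declare One_nat_def [simp del]

abbreviation free :: "nat set \<Rightarrow> nat set" where
  "free \<Lambda> \<equiv> {1..n} - \<Lambda>"

text \<open>The conditional density of all coordinates outside \<open>\<Lambda>\<close> given that those in \<open>\<Lambda>\<close> equal
  \<open>y\<close>, in terms of block densities.\<close>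

abbreviation cond :: "nat set \<Rightarrow> (nat \<Rightarrow> 'a) \<Rightarrow> (nat \<Rightarrow> 'a) \<Rightarrow> real" where
  "cond \<Lambda> y \<equiv> block_density M {1..n} (free \<Lambda>) \<pi> y"

abbreviation blocks :: "nat set \<Rightarrow> nat \<Rightarrow> nat set set" where
  "blocks \<Lambda> l \<equiv> {\<Gamma>. \<Gamma> \<subseteq> free \<Lambda> \<and> card \<Gamma> = l}"

lemma redraw_free:
  assumes "\<Lambda> \<subseteq> {1..n}"
  shows "redraw {1..n} (free \<Lambda>) y z = merge \<Lambda> (free \<Lambda>) (y, z)"
proof -
  have "{1..n} - free \<Lambda> = \<Lambda>" using assms by auto
  then have "redraw {1..n} (free \<Lambda>) y z = merge (free \<Lambda>) \<Lambda> (z, y)"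
    by (simp add: redraw_def)
  also have "\<dots> = merge \<Lambda> (free \<Lambda>) (y, z)"
    by (rule merge_commute) auto
  finally show ?thesis .
qed

lemma marginal_eq_block_mass:
  assumes "\<Lambda> \<subseteq> {1..n}"
  shows "marginal n M \<pi> \<Lambda> y = block_mass M {1..n} (free \<Lambda>) \<pi> y"
  by (simp add: marginal_def block_mass_def redraw_free[OF assms])

lemma marginal_empty: "marginal n M \<pi> {} y = 1"
proof -
  have "marginal n M \<pi> {} y = (\<integral>z. \<pi> z \<partial>Pi\<^sub>M {1..n} M)"
  proof -
    have "merge {} {1..n} (y, z) = z" if "z \<in> space (Pi\<^sub>M {1..n} M)" for z
      using that by (auto simp: merge_def space_PiM PiE_def extensional_def fun_eq_iff)
    then show ?thesis
      unfolding marginal_def by (auto intro!: Bochner_Integration.integral_cong)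
  qed
  also have "\<dots> = enn2real (\<integral>\<^sup>+z. ennreal (\<pi> z) \<partial>Pi\<^sub>M {1..n} M)"
    by (intro integral_eq_nn_integral) (auto intro!: AE_I2 joint.h_nonneg)
  finally show ?thesis by (simp add: joint.h_total)
qed

lemma cond_density_eq:
  assumes \<Gamma>: "\<Gamma> \<subseteq> {1..n}" and y: "y \<in> space (Pi\<^sub>M (free \<Gamma>) M)" and pos: "0 < marginal n M \<pi> (free \<Gamma>) y"
    and w: "w \<in> space (Pi\<^sub>M \<Gamma> M)"
  shows "cond_density n M \<pi> alt \<Gamma> (free \<Gamma>) y w = block_density M {1..n} \<Gamma> \<pi> y w"
proof -
  have f: "free (free \<Gamma>) = \<Gamma>" and un: "free \<Gamma> \<union> \<Gamma> = {1..n}" using \<Gamma> by auto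
  have m: "merge (free \<Gamma>) \<Gamma> (y, w) = redraw {1..n} \<Gamma> y w"
    unfolding redraw_def by (rule merge_commute) auto
  have "merge (free \<Gamma>) \<Gamma> (y, w) \<in> space (Pi\<^sub>M (free \<Gamma> \<union> \<Gamma>) M)"
    using y w by (intro measurable_space[OF measurable_merge]) (auto simp: space_pair_measure)
  then have full: "marginal n M \<pi> (free \<Gamma> \<union> \<Gamma>) (merge (free \<Gamma>) \<Gamma> (y, w)) = \<pi> (redraw {1..n} \<Gamma> y w)"
    unfolding un m by (rule marginal_full)
  have mass: "marginal n M \<pi> (free \<Gamma>) y = block_mass M {1..n} \<Gamma> \<pi> y"
    using marginal_eq_block_mass[of "free \<Gamma>" y] unfolding f by simp
  show ?thesis
  proof (cases "free \<Gamma> = {}")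
    case True
    then have [simp]: "\<Gamma> = {1..n}" using \<Gamma> by auto
    have "redraw {1..n} \<Gamma> y w = w"
      using w by (auto simp: redraw_def merge_def space_PiM PiE_def extensional_def fun_eq_iff)
    then show ?thesis
      using marginal_empty[of y] w mass
      by (simp add: cond_density_def block_density_def marginal_full)
  next
    case False
    show ?thesis
      unfolding cond_density_def if_not_P[OF False] if_P[OF pos]
      unfolding full mass block_density_def ..
  qed
qed

text \<open>
  The conditions \<open>y\<close> at which conditional laws are defined. Since the marginal over the empty
  index set is \<open>1\<close>, no separate case for \<open>\<Lambda> = {}\<close> is needed (\<open>admissible_iff\<close>).
\<close>

definition admissible :: "nat set \<Rightarrow> (nat \<Rightarrow> 'a) \<Rightarrow> bool" where
  "admissible \<Lambda> y \<longleftrightarrow> \<Lambda> \<subseteq> {1..n} \<and> y \<in> space (Pi\<^sub>M \<Lambda> M) \<and> 0 < marginal n M \<pi> \<Lambda> y"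

lemma product_density_cond:
  assumes "admissible \<Lambda> y"
  shows "product_density M (free \<Lambda>) (cond \<Lambda> y)"
proof -
  have \<Lambda>: "\<Lambda> \<subseteq> {1..n}" and y: "y \<in> space (Pi\<^sub>M \<Lambda> M)" and pos: "0 < marginal n M \<pi> \<Lambda> y"
    using assms by (auto simp: admissible_def)
  have un: "\<Lambda> \<union> free \<Lambda> = {1..n}" using \<Lambda> by auto
  have "space (Pi\<^sub>M (free \<Lambda>) M) \<noteq> {}"
  proof
    assume "space (Pi\<^sub>M (free \<Lambda>) M) = {}"
    then have "marginal n M \<pi> \<Lambda> y = 0" unfolding marginal_def by (rule Bochner_Integration.integral_empty)
    with pos show False by simp
  qed
  then obtain z where z: "z \<in> space (Pi\<^sub>M (free \<Lambda>) M)" by blast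
  let ?x = "redraw {1..n} (free \<Lambda>) y z"
  have "merge \<Lambda> (free \<Lambda>) (y, z) \<in> space (Pi\<^sub>M (\<Lambda> \<union> free \<Lambda>) M)"
    using y z by (intro measurable_space[OF measurable_merge]) (auto simp: space_pair_measure)
  then have "?x \<in> space (Pi\<^sub>M {1..n} M)" unfolding un redraw_free[OF \<Lambda>] .
  then have "product_density M (free \<Lambda>) (block_density M {1..n} (free \<Lambda>) \<pi> ?x)"
    using pos by (intro joint.product_density_block) (auto simp: block_mass_redraw marginal_eq_block_mass[OF \<Lambda>])
  then show ?thesis by (simp add: block_density_redraw)
qed

lemma gibbs_target_eq:
  assumes "admissible \<Lambda> y"
  shows "gibbs_target n M \<pi> alt \<Lambda> y = density (Pi\<^sub>M (free \<Lambda>) M) (\<lambda>z. ennreal (cond \<Lambda> y z))"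
proof -
  interpret product_density M "free \<Lambda>" "cond \<Lambda> y" using assms by (rule product_density_cond)
  have \<Lambda>: "\<Lambda> \<subseteq> {1..n}" and y: "y \<in> space (Pi\<^sub>M \<Lambda> M)" and pos: "0 < marginal n M \<pi> \<Lambda> y"
    using assms by (auto simp: admissible_def)
  have f: "free (free \<Lambda>) = \<Lambda>" using \<Lambda> by auto
  have eq: "cond_density n M \<pi> alt (free \<Lambda>) \<Lambda> y z = cond \<Lambda> y z" if "z \<in> space (Pi\<^sub>M (free \<Lambda>) M)" for z
    using cond_density_eq[of "free \<Lambda>" y z] that y pos unfolding f by simp
  have "cond_density n M \<pi> alt (free \<Lambda>) \<Lambda> y \<in> borel_measurable (Pi\<^sub>M (free \<Lambda>) M)"
    using h_measurable by (subst measurable_cong[OF eq]) auto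
  then show ?thesis
    unfolding gibbs_target_def using eq by (intro density_cong) auto
qed

lemma block_update_eq:
  assumes adm: "admissible \<Lambda> y" and \<Gamma>: "\<Gamma> \<subseteq> free \<Lambda>" and z: "z \<in> space (Pi\<^sub>M (free \<Lambda>) M)"
    and pos: "0 < block_mass M (free \<Lambda>) \<Gamma> (cond \<Lambda> y) z"
  shows "block_update n M \<pi> alt \<Lambda> \<Gamma> (merge \<Lambda> (free \<Lambda>) (y, z)) = resample M (free \<Lambda>) \<Gamma> (cond \<Lambda> y) z"
proof -
  interpret product_density M "free \<Lambda>" "cond \<Lambda> y" using adm by (rule product_density_cond)
  interpret z: product_density M \<Gamma> "block_density M (free \<Lambda>) \<Gamma> (cond \<Lambda> y) z"
    using \<Gamma> z pos by (rule product_density_block)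
  have \<Lambda>: "\<Lambda> \<subseteq> {1..n}" and y: "y \<in> space (Pi\<^sub>M \<Lambda> M)" and mpos: "0 < block_mass M {1..n} (free \<Lambda>) \<pi> y"
    using adm by (auto simp: admissible_def marginal_eq_block_mass)
  define x where "x = merge \<Lambda> (free \<Lambda>) (y, z)"
  have x_redraw: "x = redraw {1..n} (free \<Lambda>) y z" by (simp add: x_def redraw_free[OF \<Lambda>])
  have un: "\<Lambda> \<union> free \<Lambda> = {1..n}" using \<Lambda> by auto
  have "merge \<Lambda> (free \<Lambda>) (y, z) \<in> space (Pi\<^sub>M (\<Lambda> \<union> free \<Lambda>) M)"
    using y z by (intro measurable_space[OF measurable_merge]) (auto simp: space_pair_measure)
  then have x: "x \<in> space (Pi\<^sub>M {1..n} M)" unfolding un x_def .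
  then have xr: "restrict x (free \<Gamma>) \<in> space (Pi\<^sub>M (free \<Gamma>) M)"
    by (rule measurable_space[OF measurable_restrict_subset, rotated]) auto
  have \<Gamma>n: "\<Gamma> \<subseteq> {1..n}" using \<Gamma> by auto
  have ff: "free (free \<Gamma>) = \<Gamma>" using \<Gamma>n by auto
  have "0 < block_mass M {1..n} \<Gamma> \<pi> x"
    using pos mpos block_mass_nested[OF \<Gamma>, of "{1..n}" M \<pi> y z] 
    by (simp add: x_redraw zero_less_divide_iff)
  then have pos_x: "0 < marginal n M \<pi> (free \<Gamma>) (restrict x (free \<Gamma>))"
    using marginal_eq_block_mass[of "free \<Gamma>" "restrict x (free \<Gamma>)"] by (simp add: ff block_mass_restrict)
  have eq: "cond_density n M \<pi> alt \<Gamma> (free \<Gamma>) (restrict x (free \<Gamma>)) w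
      = block_density M (free \<Lambda>) \<Gamma> (cond \<Lambda> y) z w" if w: "w \<in> space (Pi\<^sub>M \<Gamma> M)" for w
    using cond_density_eq[OF \<Gamma>n xr pos_x w] block_density_nested[OF \<Gamma> _ mpos, of z w]
    by (simp add: block_density_restrict x_redraw)
  have meas: "cond_density n M \<pi> alt \<Gamma> (free \<Gamma>) (restrict x (free \<Gamma>)) \<in> borel_measurable (Pi\<^sub>M \<Gamma> M)"
    using z.h_measurable by (subst measurable_cong[OF eq]) auto
  have "density (Pi\<^sub>M \<Gamma> M) (\<lambda>w. ennreal (cond_density n M \<pi> alt \<Gamma> (free \<Gamma>) (restrict x (free \<Gamma>)) w)) = z.\<nu>"
    using meas eq by (intro density_cong) auto
  moreover have "restrict (merge \<Gamma> (free \<Gamma>) (w, x)) (free \<Lambda>) = redraw (free \<Lambda>) \<Gamma> z w" for w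
    using \<Gamma> by (auto simp: x_def redraw_def merge_def fun_eq_iff)
  ultimately show ?thesis
    using pos unfolding x_def[symmetric] by (simp add: block_update_def resample_def)
qed

lemma projection_mixture_gibbs:
  assumes adm: "admissible \<Lambda> y" and l: "l \<le> card (free \<Lambda>)"
  shows "projection_mixture (density (Pi\<^sub>M (free \<Lambda>) M) (\<lambda>z. ennreal (cond \<Lambda> y z))) (blocks \<Lambda> l)
    (\<lambda>\<Gamma>. resample M (free \<Lambda>) \<Gamma> (cond \<Lambda> y)) (gibbs_kernel n M \<pi> alt \<Lambda> y l)"
proof -
  interpret product_density M "free \<Lambda>" "cond \<Lambda> y" using adm by (rule product_density_cond)
  have fin: "finite (blocks \<Lambda> l)"
    by (rule finite_subset[of _ "Pow (free \<Lambda>)"]) auto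
  have ne: "blocks \<Lambda> l \<noteq> {}"
    using obtain_subset_with_card_n[OF l] by blast
  show ?thesis
  proof (intro projection_mixture.intro projection_mixture_axioms.intro prob_space_\<nu> fin ne)
    fix \<Gamma> assume "\<Gamma> \<in> blocks \<Lambda> l"
    then show "projection_kernel \<nu> (resample M (free \<Lambda>) \<Gamma> (cond \<Lambda> y))"
      by (intro projection_kernel_resample) auto
  next
    have "AE z in \<nu>. \<forall>\<Gamma>\<in>blocks \<Lambda> l. 0 < block_mass M (free \<Lambda>) \<Gamma> (cond \<Lambda> y) z"
      using fin by (intro AE_finite_allI AE_block_mass_pos) auto
    then show "AE z in \<nu>. \<forall>f. (\<forall>\<Gamma>\<in>blocks \<Lambda> l. integrable (resample M (free \<Lambda>) \<Gamma> (cond \<Lambda> y) z) f) \<longrightarrow>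
      kernel_op (gibbs_kernel n M \<pi> alt \<Lambda> y l) f z
        = (\<Sum>\<Gamma>\<in>blocks \<Lambda> l. kernel_op (resample M (free \<Lambda>) \<Gamma> (cond \<Lambda> y)) f z) / real (card (blocks \<Lambda> l))"
      using AE_space
    proof eventually_elim
      case (elim z)
      then have z: "z \<in> space (Pi\<^sub>M (free \<Lambda>) M)" by simp
      let ?R = "\<lambda>\<Gamma>. resample M (free \<Lambda>) \<Gamma> (cond \<Lambda> y) z"
      have K: "gibbs_kernel n M \<pi> alt \<Lambda> y l z = uniform_count_measure (blocks \<Lambda> l) \<bind> ?R"
        unfolding gibbs_kernel_def
        by (intro bind_cong refl block_update_eq[OF adm _ z])
           (use elim in \<open>auto simp: space_uniform_count_measure\<close>)
      have R: "?R \<Gamma> \<in> space (subprob_algebra (Pi\<^sub>M (free \<Lambda>) M))" if "\<Gamma> \<in> blocks \<Lambda> l" for \<Gamma>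
        using measurable_space[OF measurable_prob_algebraD[OF measurable_resample] z] that by auto
      show ?case
      proof (intro allI impI)
        fix f :: "(nat \<Rightarrow> 'a) \<Rightarrow> real"
        assume f: "\<forall>\<Gamma>\<in>blocks \<Lambda> l. integrable (?R \<Gamma>) f"
        show "kernel_op (gibbs_kernel n M \<pi> alt \<Lambda> y l) f z
          = (\<Sum>\<Gamma>\<in>blocks \<Lambda> l. kernel_op (resample M (free \<Lambda>) \<Gamma> (cond \<Lambda> y)) f z) / real (card (blocks \<Lambda> l))"
          unfolding kernel_op_def K
          by (rule integral_uniform_bind[OF fin ne R bspec[OF f]])
      qed
    qed
  qed
qed

lemma gibbs_gap_eq:
  assumes "admissible \<Lambda> y"
  shows "gibbs_gap n M \<pi> alt \<Lambda> y l
    = spectral_gap (density (Pi\<^sub>M (free \<Lambda>) M) (\<lambda>z. ennreal (cond \<Lambda> y z))) (gibbs_kernel n M \<pi> alt \<Lambda> y l)"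
  using assms by (simp add: gibbs_gap_def gibbs_target_eq)

lemma gibbs_gap_bounds:
  assumes "admissible \<Lambda> y" "l \<le> card (free \<Lambda>)"
  shows "0 \<le> gibbs_gap n M \<pi> alt \<Lambda> y l" "gibbs_gap n M \<pi> alt \<Lambda> y l \<le> 1"
  using projection_mixture.spectral_gap_nonneg[OF projection_mixture_gibbs[OF assms]]
    projection_mixture.spectral_gap_le_1[OF projection_mixture_gibbs[OF assms]]
  by (auto simp: gibbs_gap_eq[OF assms(1)])

lemma poincare_gibbs_gap:
  assumes "admissible \<Lambda> y" "l \<le> card (free \<Lambda>)"
  shows "poincare (density (Pi\<^sub>M (free \<Lambda>) M) (\<lambda>z. ennreal (cond \<Lambda> y z))) (blocks \<Lambda> l)
    (\<lambda>\<Gamma>. resample M (free \<Lambda>) \<Gamma> (cond \<Lambda> y)) (gibbs_gap n M \<pi> alt \<Lambda> y l)"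
  unfolding gibbs_gap_eq[OF assms(1)]
  by (rule projection_mixture.poincare_spectral_gap[OF projection_mixture_gibbs[OF assms]])

lemma gibbs_gap_greatest:
  assumes "admissible \<Lambda> y" "l \<le> card (free \<Lambda>)"
    and "poincare (density (Pi\<^sub>M (free \<Lambda>) M) (\<lambda>z. ennreal (cond \<Lambda> y z))) (blocks \<Lambda> l)
      (\<lambda>\<Gamma>. resample M (free \<Lambda>) \<Gamma> (cond \<Lambda> y)) g" "g \<le> 1"
  shows "g \<le> gibbs_gap n M \<pi> alt \<Lambda> y l"
  unfolding gibbs_gap_eq[OF assms(1)]
  by (rule projection_mixture.spectral_gap_greatest[OF projection_mixture_gibbs[OF assms(1,2)] assms(3,4)])

lemma ex_admissible:
  assumes \<Lambda>: "\<Lambda> \<subseteq> {1..n}"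
  shows "\<exists>y. admissible \<Lambda> y"
proof -
  have f: "{1..n} - free \<Lambda> = \<Lambda>" using \<Lambda> by auto
  interpret prob_space joint.\<nu> by (rule joint.prob_space_\<nu>)
  have "AE x in joint.\<nu>. admissible \<Lambda> (restrict x \<Lambda>)"
    using joint.AE_block_mass_pos[of "free \<Lambda>", OF Diff_subset] AE_space
  proof eventually_elim
    case (elim x)
    then have "restrict x \<Lambda> \<in> space (Pi\<^sub>M \<Lambda> M)"
      using measurable_space[OF measurable_restrict_subset[OF \<Lambda>]] by simp
    moreover have "0 < marginal n M \<pi> \<Lambda> (restrict x \<Lambda>)"
      using elim(1) block_mass_restrict[of M "{1..n}" "free \<Lambda>" \<pi> x] marginal_eq_block_mass[OF \<Lambda>]
      unfolding f by simp
    ultimately show ?case using \<Lambda> by (simp add: admissible_def)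
  qed
  then have "AE x in joint.\<nu>. \<exists>y. admissible \<Lambda> y"
    by eventually_elim blast
  then show ?thesis by simp
qed

text \<open>Conditioning the target given \<open>y\<close> further on the coordinate \<open>i\<close> gives the target with the
  extended index set \<open>insert i \<Lambda>\<close>.\<close>

lemma admissible_extend:
  assumes adm: "admissible \<Lambda> y" and i: "i \<in> free \<Lambda>" and z: "z \<in> space (Pi\<^sub>M (free \<Lambda>) M)"
    and pos: "0 < block_mass M (free \<Lambda>) (free \<Lambda> - {i}) (cond \<Lambda> y) z"
  defines "y' \<equiv> restrict (merge \<Lambda> (free \<Lambda>) (y, z)) (insert i \<Lambda>)"
  shows "admissible (insert i \<Lambda>) y'"
    and "block_density M (free \<Lambda>) (free \<Lambda> - {i}) (cond \<Lambda> y) z = cond (insert i \<Lambda>) y'"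
proof -
  have \<Lambda>: "\<Lambda> \<subseteq> {1..n}" and y: "y \<in> space (Pi\<^sub>M \<Lambda> M)" and mpos: "0 < block_mass M {1..n} (free \<Lambda>) \<pi> y"
    using adm by (auto simp: admissible_def marginal_eq_block_mass)
  define x where "x = merge \<Lambda> (free \<Lambda>) (y, z)"
  have x_redraw: "x = redraw {1..n} (free \<Lambda>) y z" by (simp add: x_def redraw_free[OF \<Lambda>])
  have un: "\<Lambda> \<union> free \<Lambda> = {1..n}" using \<Lambda> by auto
  have "merge \<Lambda> (free \<Lambda>) (y, z) \<in> space (Pi\<^sub>M (\<Lambda> \<union> free \<Lambda>) M)"
    using y z by (intro measurable_space[OF measurable_merge]) (auto simp: space_pair_measure)
  then have x: "x \<in> space (Pi\<^sub>M {1..n} M)" unfolding un x_def .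
  have \<Lambda>i: "insert i \<Lambda> \<subseteq> {1..n}" using \<Lambda> i by auto
  have fr: "free \<Lambda> - {i} = free (insert i \<Lambda>)" "{1..n} - free (insert i \<Lambda>) = insert i \<Lambda>" using \<Lambda>i by auto
  have sub: "free (insert i \<Lambda>) \<subseteq> free \<Lambda>" by auto
  have y': "y' = restrict x (insert i \<Lambda>)" by (simp add: y'_def x_def)
  have "y' \<in> space (Pi\<^sub>M (insert i \<Lambda>) M)"
    unfolding y' using measurable_space[OF measurable_restrict_subset[OF \<Lambda>i]] x by blast
  moreover have "0 < block_mass M {1..n} (free (insert i \<Lambda>)) \<pi> x"
    using pos mpos block_mass_nested[OF sub, of "{1..n}" M \<pi> y z]
    unfolding fr by (simp add: x_redraw zero_less_divide_iff)
  ultimately show "admissible (insert i \<Lambda>) y'"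
    using \<Lambda>i block_mass_restrict[of M "{1..n}" "free (insert i \<Lambda>)" \<pi> x]
    unfolding fr by (simp add: admissible_def marginal_eq_block_mass y')
  show "block_density M (free \<Lambda>) (free \<Lambda> - {i}) (cond \<Lambda> y) z = cond (insert i \<Lambda>) y'"
    unfolding fr(1) using block_density_restrict[of M "{1..n}" "free (insert i \<Lambda>)" \<pi> x]
      block_density_nested[OF sub _ mpos, of z]
    unfolding fr(2) by (simp add: fun_eq_iff x_redraw y')
qed

lemma admissible_iff:
  "\<Lambda> \<subseteq> {1..n} \<Longrightarrow> {y \<in> space (Pi\<^sub>M \<Lambda> M). \<Lambda> = {} \<or> 0 < marginal n M \<pi> \<Lambda> y} = {y. admissible \<Lambda> y}"
  by (auto simp: admissible_def marginal_empty)

lemma Gap_eq: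
  "Gap n M \<pi> alt m l =
     Min ((\<lambda>\<Lambda>. INF y\<in>{y. admissible \<Lambda> y}. gibbs_gap n M \<pi> alt \<Lambda> y l) ` {\<Lambda>. \<Lambda> \<subseteq> {1..n} \<and> card \<Lambda> = n - m})"
  unfolding Gap_def by (intro arg_cong[where f=Min] image_cong refl) (auto simp: admissible_iff)

lemma finite_index_sets: "finite {\<Lambda>. \<Lambda> \<subseteq> {1..n} \<and> card \<Lambda> = k}"
  by (rule finite_subset[of _ "Pow {1..n}"]) auto

lemma card_free: "\<Lambda> \<subseteq> {1..n} \<Longrightarrow> card \<Lambda> = n - m \<Longrightarrow> m \<le> n \<Longrightarrow> card (free \<Lambda>) = m"
  by (simp add: card_Diff_subset finite_subset)

lemma Gap_le:
  assumes "l \<le> m" "m \<le> n" "card \<Lambda> = n - m" and adm: "admissible \<Lambda> y"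
  shows "Gap n M \<pi> alt m l \<le> gibbs_gap n M \<pi> alt \<Lambda> y l"
proof -
  have \<Lambda>: "\<Lambda> \<subseteq> {1..n}" using adm by (simp add: admissible_def)
  have c: "card (free \<Lambda>) = m" using \<Lambda> assms(3,2) by (rule card_free)
  have "Gap n M \<pi> alt m l \<le> (INF y\<in>{y. admissible \<Lambda> y}. gibbs_gap n M \<pi> alt \<Lambda> y l)"
    unfolding Gap_eq using \<Lambda> assms by (intro Min_le finite_imageI finite_index_sets) auto
  also have "\<dots> \<le> gibbs_gap n M \<pi> alt \<Lambda> y l"
    using adm gibbs_gap_bounds(1)[of \<Lambda> _ l] c assms(1) by (intro cINF_lower bdd_belowI2[where m=0]) auto
  finally show ?thesis .
qed

lemma Gap_greatest:
  assumes "m \<le> n"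
    and "\<And>\<Lambda> y. card \<Lambda> = n - m \<Longrightarrow> admissible \<Lambda> y \<Longrightarrow> g \<le> gibbs_gap n M \<pi> alt \<Lambda> y l"
  shows "g \<le> Gap n M \<pi> alt m l"
proof -
  have "n - m \<le> card {1..n}" by simp
  then obtain \<Lambda> where "\<Lambda> \<subseteq> {1..n}" "card \<Lambda> = n - m"
    by (rule obtain_subset_with_card_n)
  moreover have "g \<le> (INF y\<in>{y. admissible \<Lambda> y}. gibbs_gap n M \<pi> alt \<Lambda> y l)"
    if "\<Lambda> \<subseteq> {1..n}" "card \<Lambda> = n - m" for \<Lambda>
    using ex_admissible[OF that(1)] assms(2)[OF that(2)] by (intro cINF_greatest) auto
  ultimately show ?thesis
    unfolding Gap_eq by (intro Min.boundedI finite_imageI finite_index_sets) auto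
qed

lemma Gap_nonneg: "l \<le> m \<Longrightarrow> m \<le> n \<Longrightarrow> 0 \<le> Gap n M \<pi> alt m l"
  by (rule Gap_greatest) (auto intro!: gibbs_gap_bounds simp: card_free admissible_def)

lemma Gap_le_1:
  assumes "l \<le> m" "m \<le> n"
  shows "Gap n M \<pi> alt m l \<le> 1"
proof -
  have "n - m \<le> card {1..n}" by simp
  then obtain \<Lambda> where \<Lambda>: "\<Lambda> \<subseteq> {1..n}" "card \<Lambda> = n - m"
    by (rule obtain_subset_with_card_n)
  obtain y where y: "admissible \<Lambda> y" using ex_admissible[OF \<Lambda>(1)] ..
  have "Gap n M \<pi> alt m l \<le> gibbs_gap n M \<pi> alt \<Lambda> y l"
    using assms \<Lambda>(2) y by (rule Gap_le)
  also have "\<dots> \<le> 1"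
    using y card_free[OF \<Lambda> assms(2)] assms(1) by (intro gibbs_gap_bounds) auto
  finally show ?thesis .
qed

lemma Gap_submultiplicative:
  assumes l: "l < m" and m: "m \<le> n"
  shows "Gap n M \<pi> alt m (m - 1) * Gap n M \<pi> alt (m - 1) l \<le> Gap n M \<pi> alt m l"
proof (rule Gap_greatest[OF m])
  let ?g1 = "Gap n M \<pi> alt m (m - 1)" and ?g2 = "Gap n M \<pi> alt (m - 1) l"
  have g: "0 \<le> ?g1" "?g1 \<le> 1" "0 \<le> ?g2" "?g2 \<le> 1"
    using l m by (auto intro!: Gap_nonneg Gap_le_1)
  fix \<Lambda> y assume \<Lambda>c: "card \<Lambda> = n - m" and adm: "admissible \<Lambda> y"
  interpret product_density M "free \<Lambda>" "cond \<Lambda> y" using adm by (rule product_density_cond)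
  have \<Lambda>: "\<Lambda> \<subseteq> {1..n}" using adm by (simp add: admissible_def)
  have c: "card (free \<Lambda>) = m" using \<Lambda> \<Lambda>c m by (rule card_free)
  have "poincare \<nu> (blocks \<Lambda> l) (\<lambda>\<Gamma>. resample M (free \<Lambda>) \<Gamma> (cond \<Lambda> y)) (?g1 * ?g2)"
  proof (rule poincare_compose)
    show "free \<Lambda> \<noteq> {}" using c l by (intro notI) simp
    show "l < card (free \<Lambda>)" using c l by simp
    have le1: "?g1 \<le> gibbs_gap n M \<pi> alt \<Lambda> y (m - 1)"
      using m \<Lambda>c adm by (intro Gap_le) auto
    show "poincare \<nu> (blocks \<Lambda> (card (free \<Lambda>) - 1)) (\<lambda>\<Gamma>. resample M (free \<Lambda>) \<Gamma> (cond \<Lambda> y)) ?g1"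
      unfolding c by (rule poincare_mono[OF prob_space_\<nu> poincare_gibbs_gap[OF adm] le1]) (use c in simp)
    show "0 \<le> ?g2" by (rule g)
    fix i z assume i: "i \<in> free \<Lambda>" and z: "z \<in> space (Pi\<^sub>M (free \<Lambda>) M)"
      and pos: "0 < block_mass M (free \<Lambda>) (free \<Lambda> - {i}) (cond \<Lambda> y) z"
    define y' where "y' = restrict (merge \<Lambda> (free \<Lambda>) (y, z)) (insert i \<Lambda>)"
    have adm': "admissible (insert i \<Lambda>) y'"
      and dens: "block_density M (free \<Lambda>) (free \<Lambda> - {i}) (cond \<Lambda> y) z = cond (insert i \<Lambda>) y'"
      unfolding y'_def using admissible_extend[OF adm i z pos] by auto
    have fr: "free \<Lambda> - {i} = free (insert i \<Lambda>)" by auto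
    interpret i: product_density M "free (insert i \<Lambda>)" "cond (insert i \<Lambda>) y'"
      using adm' by (rule product_density_cond)
    have ci: "card (insert i \<Lambda>) = n - (m - 1)"
      using \<Lambda>c \<Lambda> i l m by (simp add: finite_subset)
    then have cf: "card (free (insert i \<Lambda>)) = m - 1"
      using adm' m by (intro card_free) (auto simp: admissible_def)
    have le: "?g2 \<le> gibbs_gap n M \<pi> alt (insert i \<Lambda>) y' l"
      using l m ci adm' by (intro Gap_le) auto
    show "poincare (density (Pi\<^sub>M (free \<Lambda> - {i}) M)
          (\<lambda>w. ennreal (block_density M (free \<Lambda>) (free \<Lambda> - {i}) (cond \<Lambda> y) z w)))
        {\<Gamma>. \<Gamma> \<subseteq> free \<Lambda> - {i} \<and> card \<Gamma> = l}
        (\<lambda>\<Gamma>. resample M (free \<Lambda> - {i}) \<Gamma> (block_density M (free \<Lambda>) (free \<Lambda> - {i}) (cond \<Lambda> y) z)) ?g2"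
      unfolding dens unfolding fr
      by (rule poincare_mono[OF i.prob_space_\<nu> poincare_gibbs_gap[OF adm'] le]) (use cf l in simp)
  qed
  then show "?g1 * ?g2 \<le> gibbs_gap n M \<pi> alt \<Lambda> y l"
    using adm c l g by (intro gibbs_gap_greatest) (auto intro: mult_le_one)
qed

lemma Gap_ge_prod:
  assumes "l < m" "m \<le> n"
  shows "(\<Prod>k = l + 1..m. Gap n M \<pi> alt k (k - 1)) \<le> Gap n M \<pi> alt m l"
proof -
  have "Suc l \<le> m" using assms by simp
  then show ?thesis using assms(2)
  proof (induction m rule: dec_induct)
    case base
    then show ?case by simp
  next
    case (step k)
    have "(\<Prod>j = l + 1..Suc k. Gap n M \<pi> alt j (j - 1))
        = Gap n M \<pi> alt (Suc k) k * (\<Prod>j = l + 1..k. Gap n M \<pi> alt j (j - 1))"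
      using step by (simp add: prod.nat_ivl_Suc' mult.commute)
    also have "\<dots> \<le> Gap n M \<pi> alt (Suc k) k * Gap n M \<pi> alt k l"
      using step by (intro mult_left_mono Gap_nonneg) auto
    also have "\<dots> \<le> Gap n M \<pi> alt (Suc k) l"
      using Gap_submultiplicative[of l "Suc k"] step by simp
    finally show ?case .
  qed
qed

end

theorem theorem2:
  fixes n :: nat
    and M :: "nat \<Rightarrow> 'a measure"
    and P :: "'w measure"
    and X :: "nat \<Rightarrow> 'w \<Rightarrow> 'a"
    and \<pi> :: "(nat \<Rightarrow> 'a) \<Rightarrow> real"
    and alt :: "nat set \<Rightarrow> nat set \<Rightarrow> (nat \<Rightarrow> 'a) \<Rightarrow> (nat \<Rightarrow> 'a) \<Rightarrow> real"
  assumes "n \<ge> 2"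
    and "\<And>i. i \<in> {1..n} \<Longrightarrow> sigma_finite_measure (M i)"
    and "\<And>i x. i \<in> {1..n} \<Longrightarrow> x \<in> space (M i) \<Longrightarrow> {x} \<in> sets (M i)"
    and "prob_space P"
    and "\<And>x. x \<in> space (Pi\<^sub>M {1..n} M) \<Longrightarrow> 0 \<le> \<pi> x"
    and "distributed P (Pi\<^sub>M {1..n} M) (\<lambda>\<omega>. \<lambda>i\<in>{1..n}. X i \<omega>) (\<lambda>x. ennreal (\<pi> x))"
    and "\<And>\<Gamma> \<Lambda> y. \<Gamma> \<subseteq> {1..n} \<Longrightarrow> \<Lambda> \<subseteq> {1..n} \<Longrightarrow> \<Gamma> \<noteq> {} \<Longrightarrow> \<Lambda> \<noteq> {} \<Longrightarrow> \<Gamma> \<inter> \<Lambda> = {} \<Longrightarrow>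
           y \<in> space (Pi\<^sub>M \<Lambda> M) \<Longrightarrow> marginal n M \<pi> \<Lambda> y = 0 \<Longrightarrow>
           prob_density (Pi\<^sub>M \<Gamma> M) (alt \<Gamma> \<Lambda> y)"
  shows "(\<forall>l\<in>{1..n - 1}. \<forall>m\<in>{l + 1..n}.
            Gap n M \<pi> alt m l \<ge> Gap n M \<pi> alt m (m - 1) * Gap n M \<pi> alt (m - 1) l) \<and>
         (\<forall>l\<in>{1..n - 1}. Gap n M \<pi> alt n l \<ge> (\<Prod>m = l + 1..n. Gap n M \<pi> alt m (m - 1)))"
proof -
  let ?S = "Pi\<^sub>M {1..n} M" and ?X = "\<lambda>\<omega>. \<lambda>i\<in>{1..n}. X i \<omega>"
  note dist = assms(6)
  have "(\<lambda>x. ennreal (\<pi> x)) \<in> borel_measurable ?S"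
    using dist by (rule distributed_borel_measurable)
  then have "(\<lambda>x. enn2real (ennreal (\<pi> x))) \<in> borel_measurable ?S"
    by measurable
  then have meas: "\<pi> \<in> borel_measurable ?S"
    using assms(5) by (subst measurable_cong[where g="\<lambda>x. enn2real (ennreal (\<pi> x))"]) auto
  have X: "?X \<in> P \<rightarrow>\<^sub>M ?S" using dist by (rule distributed_measurable)
  have "(\<integral>\<^sup>+x. ennreal (\<pi> x) \<partial>?S) = (\<integral>\<^sup>+x. 1 \<partial>density ?S (\<lambda>x. ennreal (\<pi> x)))"
    using meas by (subst nn_integral_density) auto
  also have "\<dots> = emeasure (distr P ?S ?X) (space (distr P ?S ?X))"
    unfolding distributed_distr_eq_density[OF dist] by simp
  also have "\<dots> = 1"
    by (rule prob_space.emeasure_space_1[OF prob_space.prob_space_distr[OF assms(4) X]])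
  finally interpret gibbs_setting n M \<pi> alt
    unfolding gibbs_setting_def using meas assms(2,5) by (intro product_density.intro) auto
  show ?thesis
    using Gap_submultiplicative Gap_ge_prod by auto
qed

end
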